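(* Let $k\ge2$ be a fixed integer. For each $n$ let $N=\binom n2$, let $\alpha=(\alpha_e)_{e\in E_n}$ be $M$-bounded with $M=M(n)=n^{o(1)}$, and let $G_{\Sigma,p}$ be the random graph on $[n]$ defined by a uniform random point of the simplex $\Sigma=\{X\in\mathbb{R}_+^N:\sum_{e\in E_n}\alpha_eX_e\le N\}$. Suppose that $\theta$ is fixed and satisfies $\frac1k<\theta<\frac1{k-1}$, and that $p=\frac{1}{n^{1-\theta}}$. Then with high probability the diameter of $G_{\Sigma,p}$ equals $k$.
   Context: $[n]=\{1,\dots,n\}$ and $E_n=\binom{[n]}{2}$ is the set of unordered pairs of vertices, so $|E_n|=N$. The vector $\alpha$ is $M$-bounded if $1/M\le\alpha_e\le M$ for all $e\in E_n$. Choose $X$ uniformly at random from $\Sigma$; $G_{\Sigma,p}$ is the graph with vertex set $[n]$ whose edges are the pairs $e$ with $X_e\le p$. "With high probability" means with probability tending to $1$ as $n\to\infty$. *)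

theory Defs
  imports "HOL-Analysis.Analysis" "HOL-Library.Landau_Symbols" "HOL-Library.Ramsey"
    "Graph_Theory.Graph_Theory"
begin

text \<open>
  \<open>\<mu>\<close> is the shortest-path distance of the graph library; with unit arc costs it is the
  usual graph distance, and it is \<open>\<infinity>\<close> for a pair of vertices not joined by a walk.
  So a disconnected graph has diameter \<open>\<infinity>\<close>.
\<close>

definition graph_diameter :: "'a pair_pre_digraph \<Rightarrow> ereal" where
  "graph_diameter G =
     (SUP u\<in>pverts G. SUP v\<in>pverts G. wf_digraph.\<mu> (with_proj G) (\<lambda>_. 1) u v)"

abbreviation edges_K :: "nat \<Rightarrow> nat set set" where
  "edges_K n \<equiv> nsets {1..n} 2"

definition bounded_by :: "real \<Rightarrow> nat \<Rightarrow> (nat set \<Rightarrow> real) \<Rightarrow> bool" where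
  "bounded_by M n \<alpha> \<longleftrightarrow> (\<forall>e\<in>edges_K n. 1 / M \<le> \<alpha> e \<and> \<alpha> e \<le> M)"

definition simplex_set :: "nat \<Rightarrow> (nat set \<Rightarrow> real) \<Rightarrow> (nat set \<Rightarrow> real) set" where
  "simplex_set n \<alpha> =
     {X \<in> edges_K n \<rightarrow>\<^sub>E {0..}. (\<Sum>e\<in>edges_K n. \<alpha> e * X e) \<le> real (n choose 2)}"

definition simplex_measure :: "nat \<Rightarrow> (nat set \<Rightarrow> real) \<Rightarrow> (nat set \<Rightarrow> real) measure" where
  "simplex_measure n \<alpha> =
     uniform_measure (\<Pi>\<^sub>M e\<in>edges_K n. lborel) (simplex_set n \<alpha>)"

text \<open>
  Undirected graphs are represented as symmetric loop-free digraphs, so an edge \<open>{u, v}\<close>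
  gives the two arcs \<open>(u, v)\<close> and \<open>(v, u)\<close>.
\<close>

definition threshold_graph :: "nat \<Rightarrow> real \<Rightarrow> (nat set \<Rightarrow> real) \<Rightarrow> nat pair_pre_digraph" where
  "threshold_graph n p X =
     \<lparr>pverts = {1..n}, parcs = {(u, v). {u, v} \<in> edges_K n \<and> X {u, v} \<le> p}\<rparr>"

lemma pair_graph_threshold_graph: "pair_graph (threshold_graph n p X)"
proof
  have "parcs (threshold_graph n p X) \<subseteq> {1..n} \<times> {1..n}"
    by (auto simp: threshold_graph_def nsets_def)
  then show "finite (parcs (threshold_graph n p X))"
    by (rule finite_subset) simp
  show "symmetric (with_proj (threshold_graph n p X))"
    by (auto simp: symmetric_def sym_def arcs_ends_def arc_to_ends_def threshold_graph_def
        insert_commute)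
qed (auto simp: threshold_graph_def nsets_def)

end

theory Submission
  imports Defs "HOL-Probability.Probability" "HOL-Real_Asymp.Real_Asymp"
begin

text \<open>
  Since \<open>exp (N - (\<Sum>e. \<alpha> e * X e)) \<ge> 1\<close> on the simplex, the uniform measure is at most
  \<open>fact N * exp N / N ^ N = O(N)\<close> times a product of exponential measures. Under the latter
  the edges are independent, present with probabilities \<open>1 - exp (- \<alpha> e * p)\<close>, and it suffices
  that the bad events have probability smaller than every power of \<open>n\<close>. Both do. A vertex has
  degree above \<open>n powr (\<theta> + \<epsilon>)\<close> with probability at most \<open>exp (- (n powr \<epsilon>))\<close>, and if no vertex
  has, the balls of radius \<open>k - 1\<close> have fewer than \<open>n\<close> vertices. Conversely, the exploration of
  the neighbourhood of a vertex \<open>u\<close> through disjoint reservoirs of \<open>n / k\<close> fresh vertices grows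
  by the factor \<open>n powr (\<theta> - \<epsilon>)\<close> in each of \<open>k - 1\<close> steps, and then some vertex reached is
  adjacent to a given \<open>v\<close>, since \<open>k * \<theta> > 1\<close>.
\<close>

section \<open>Diameter and walks\<close>

text \<open>Indexing graphs by Boolean edge patterns lets the diameter event be read both under the
  uniform measure on the simplex and under a product of Bernoulli laws.\<close>

definition edge_graph :: "nat \<Rightarrow> (nat set \<Rightarrow> bool) \<Rightarrow> nat pair_pre_digraph" where
  "edge_graph n g =
     \<lparr>pverts = {1..n}, parcs = {(u, v). {u, v} \<in> edges_K n \<and> g {u, v}}\<rparr>"

text \<open>The conjunct \<open>e \<in> edges_K n\<close> makes the pattern \<open>False\<close> off
  the edge set, matching the default value of the product law.\<close>

lemma threshold_graph_eq_edge_graph: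
  "threshold_graph n p X = edge_graph n (\<lambda>e. e \<in> edges_K n \<and> X e \<le> p)"
  by (auto simp: threshold_graph_def edge_graph_def)

lemma edge_graph_simps [simp]:
  "pverts (edge_graph n g) = {1..n}"
  "(u, v) \<in> parcs (edge_graph n g) \<longleftrightarrow> {u, v} \<in> edges_K n \<and> g {u, v}"
  by (simp_all add: edge_graph_def)

lemma wf_digraph_edge_graph: "wf_digraph (with_proj (edge_graph n g))"
  by unfold_locales (auto simp: edge_graph_def nsets_def)

lemma mem_edges_K_iff: "{u, v} \<in> edges_K n \<longleftrightarrow> u \<in> {1..n} \<and> v \<in> {1..n} \<and> u \<noteq> v"
  by (auto simp: nsets_def card_insert_if)

text \<open>With unit costs the cost of a walk is its length. The infimum over an empty set of walks
  is \<infinity>, as the distance requires.\<close>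

lemma graph_diameter_edge_graph:
  "graph_diameter (edge_graph n g) =
     (SUP u\<in>{1..n}. SUP v\<in>{1..n}. INF p\<in>{p. set p \<subseteq> parcs (edge_graph n g) \<and> pcas u p v}. ereal (length p))"
proof -
  interpret wf_digraph "with_proj (edge_graph n g)" by (rule wf_digraph_edge_graph)
  have "awalk_cost (\<lambda>_. 1) p = length p" for p
    by (simp add: awalk_cost_def sum_list_triv)
  moreover have "awalk u p v \<longleftrightarrow> set p \<subseteq> parcs (edge_graph n g) \<and> pcas u p v" if "u \<in> {1..n}" for u v p
    using that by (simp add: awalk_def cas_with_proj_eq)
  ultimately show ?thesis
    unfolding graph_diameter_def \<mu>_def
    by (intro SUP_cong INF_cong) auto
qed

text \<open>A walk from \<open>x\<close> to \<open>v\<close> with exactly \<open>j\<close>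
  intermediate vertices, all in \<open>V\<close>, hence with \<open>Suc j\<close> edges; vertices
  may repeat.\<close>

primrec hits :: "(nat set \<Rightarrow> bool) \<Rightarrow> nat set \<Rightarrow> nat \<Rightarrow> nat \<Rightarrow> nat \<Rightarrow> bool" where
  "hits g V v 0 x \<longleftrightarrow> g {x, v}"
| "hits g V v (Suc j) x \<longleftrightarrow> (\<exists>y\<in>V. g {x, y} \<and> hits g V v j y)"

lemma hits_mono: "hits g V v j x \<Longrightarrow> V \<subseteq> V' \<Longrightarrow> hits g V' v j x"
  by (induction j arbitrary: x) auto

text \<open>Every edge inspected has an end in \<open>V\<close> or at \<open>v\<close>, wherever the
  walk starts. This locality is what makes successive exploration steps independent.\<close>

lemma hits_cong:
  assumes "\<And>e. e \<inter> insert v V \<noteq> {} \<Longrightarrow> g e = h e"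
  shows "hits g V v j x = hits h V v j x"
proof (induction j arbitrary: x)
  case 0
  then show ?case using assms[of "{x, v}"] by auto
next
  case (Suc j)
  have "g {x, y} = h {x, y}" if "y \<in> V" for y using assms[of "{x, y}"] that by auto
  then show ?case using Suc by auto
qed

lemma hits_imp_walk:
  assumes "{e. g e} \<subseteq> edges_K n" "hits g V v j x"
  shows "\<exists>p. set p \<subseteq> parcs (edge_graph n g) \<and> pcas x p v \<and> length p = Suc j"
  using assms(2)
proof (induction j arbitrary: x)
  case 0
  then have "{x, v} \<in> edges_K n" using assms(1) unfolding hits.simps by blast
  with 0 show ?case
    by (intro exI[of _ "[(x, v)]"]) auto
next
  case (Suc j)
  then obtain y p where "g {x, y}" "set p \<subseteq> parcs (edge_graph n g)" "pcas y p v" "length p = Suc j"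
    by fastforce
  moreover from this have "{x, y} \<in> edges_K n" using assms(1) by blast
  ultimately show ?case
    by (intro exI[of _ "(x, y) # p"]) auto
qed

section \<open>Diameter bounds from walks and from balls\<close>

lemma graph_diameter_le:
  assumes "{e. g e} \<subseteq> edges_K n"
    and "\<And>u v. u \<in> {1..n} \<Longrightarrow> v \<in> {1..n} \<Longrightarrow> u \<noteq> v \<Longrightarrow> hits g ({1..n} - {u, v}) v j u"
  shows "graph_diameter (edge_graph n g) \<le> ereal (Suc j)"
  unfolding graph_diameter_edge_graph
proof (intro SUP_least)
  fix u v assume uv: "u \<in> {1..n}" "v \<in> {1..n}"
  obtain p where "set p \<subseteq> parcs (edge_graph n g)" "pcas u p v" "length p \<le> Suc j"
  proof (cases "u = v")
    case True
    then show ?thesis using that[of "[]"] by simp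
  next
    case False
    then show ?thesis
      using hits_imp_walk[OF assms(1) assms(2)[OF uv]] that by (metis order_refl)
  qed
  then show "(INF p\<in>{p. set p \<subseteq> parcs (edge_graph n g) \<and> pcas u p v}. ereal (length p)) \<le> ereal (Suc j)"
    by (intro INF_lower2[of p]) auto
qed

text \<open>The recursion is on the first edge; \<open>insert u\<close> supplies the empty walk, so
  that walks shorter than \<open>j\<close> count too.\<close>

primrec walk_ball :: "(nat set \<Rightarrow> bool) \<Rightarrow> nat \<Rightarrow> nat \<Rightarrow> nat set" where
  "walk_ball g 0 u = {u}"
| "walk_ball g (Suc j) u = insert u (\<Union>x\<in>{x. g {u, x}}. walk_ball g j x)"

lemma pcas_imp_mem_walk_ball:
  assumes "set p \<subseteq> parcs (edge_graph n g)" "pcas u p v" "length p \<le> j"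
  shows "v \<in> walk_ball g j u"
  using assms
proof (induction p arbitrary: u j)
  case Nil
  then show ?case by (cases j) auto
next
  case (Cons e p)
  then obtain j' where "j = Suc j'" by (cases j) auto
  with Cons.prems Cons.IH[of "snd e" j'] show ?case
    by (cases e) (auto simp: edge_graph_def)
qed

text \<open>One step of the recursion gives at most \<open>1 + d * Suc d ^ j\<close>, and the 1 is
  absorbed because \<open>Suc d ^ j\<close> is at least 1.\<close>

lemma card_walk_ball:
  assumes "\<And>u. finite {x. g {u, x}}" "\<And>u. card {x. g {u, x}} \<le> d"
  shows "finite (walk_ball g j u) \<and> card (walk_ball g j u) \<le> (Suc d) ^ j"
proof (induction j arbitrary: u)
  case (Suc j)
  have "card (\<Union>x\<in>{x. g {u, x}}. walk_ball g j x) \<le> (\<Sum>x\<in>{x. g {u, x}}. card (walk_ball g j x))"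
    using assms(1) by (intro card_UN_le)
  also have "\<dots> \<le> (\<Sum>x\<in>{x. g {u, x}}. (Suc d) ^ j)"
    using Suc by (intro sum_mono) auto
  also have "\<dots> \<le> d * (Suc d) ^ j"
    using assms(2) by simp
  finally have "card (walk_ball g (Suc j) u) \<le> 1 + d * (Suc d) ^ j"
    using Suc assms(1) by (simp add: card_insert_if)
  also have "\<dots> \<le> (Suc d) ^ Suc j" by simp
  finally show ?case using Suc assms(1) by auto
qed simp

text \<open>The ball of radius \<open>j\<close> about vertex 1 misses some vertex, and every walk
  from 1 to that vertex has more than \<open>j\<close> edges. If there is no such walk, the distance
  is infinite.\<close>

lemma graph_diameter_ge:
  assumes "\<And>u. finite {x. g {u, x}}" "\<And>u. card {x. g {u, x}} \<le> d" "(Suc d) ^ j < n"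
  shows "graph_diameter (edge_graph n g) \<ge> ereal (Suc j)"
proof -
  have "n > 0" using assms(3) by linarith
  have "\<not> {1..n} \<subseteq> walk_ball g j 1"
    using card_walk_ball[OF assms(1,2), of j 1] assms(3) card_mono[of "walk_ball g j 1" "{1..n}"]
    by (auto simp: not_le)
  then obtain v where v: "v \<in> {1..n}" "v \<notin> walk_ball g j 1" by blast
  have "ereal (Suc j) \<le> (INF p\<in>{p. set p \<subseteq> parcs (edge_graph n g) \<and> pcas 1 p v}. ereal (length p))"
    using v(2) pcas_imp_mem_walk_ball[of _ n g 1 v j]
    by (intro INF_greatest) (force simp: not_le)
  then show ?thesis
    unfolding graph_diameter_edge_graph using \<open>n > 0\<close> v(1)
    by (intro SUP_upper2[of 1] SUP_upper2[of v]) auto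
qed

section \<open>Domination of the uniform measure on a simplex\<close>

lemma simplex_slice_measurable:
  fixes \<alpha> :: "'a \<Rightarrow> real"
  assumes "finite A"
  shows "{X \<in> A \<rightarrow>\<^sub>E {0..}. (\<Sum>e\<in>A. \<alpha> e * X e) \<le> t} \<in> sets (Pi\<^sub>M A (\<lambda>_. lborel))"
proof -
  have "{X \<in> A \<rightarrow>\<^sub>E {0..}. (\<Sum>e\<in>A. \<alpha> e * X e) \<le> t} =
      Pi\<^sub>E A (\<lambda>_. {0..}) \<inter> (\<lambda>X. \<Sum>e\<in>A. \<alpha> e * X e) -` {..t} \<inter> space (Pi\<^sub>M A (\<lambda>_. lborel))"
    by (auto simp: space_PiM)
  also have "\<dots> \<in> sets (Pi\<^sub>M A (\<lambda>_. lborel))"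
    using assms by measurable
  finally show ?thesis .
qed

text \<open>Induction on the dimension: the slice at height \<open>y\<close> of the new coordinate
  is a simplex with bound \<open>t - a * y\<close>, so \<open>t\<close> must vary, and its volume is
  integrated over \<open>y\<close>.\<close>

lemma emeasure_weighted_simplex:
  fixes \<alpha> :: "'a \<Rightarrow> real"
  assumes "finite A" "t \<ge> 0" "\<And>e. e \<in> A \<Longrightarrow> \<alpha> e > 0"
  shows "emeasure (Pi\<^sub>M A (\<lambda>_. lborel)) {X \<in> A \<rightarrow>\<^sub>E {0..}. (\<Sum>e\<in>A. \<alpha> e * X e) \<le> t} =
           ennreal (t ^ card A / (fact (card A) * prod \<alpha> A))"
  using assms
proof (induction A arbitrary: t rule: finite_induct)
  case empty
  then show ?case by (simp add: PiM_empty)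
next
  case (insert b A)
  define m where "m = card A"
  define c where "c = fact m * prod \<alpha> A"
  define a where "a = \<alpha> b"
  have a: "a > 0" using insert.prems by (simp add: a_def)
  have c: "c > 0" unfolding c_def using insert.prems by (intro mult_pos_pos prod_pos) auto
  let ?M = "\<lambda>A. Pi\<^sub>M A (\<lambda>_. lborel :: real measure)"
  let ?S = "\<lambda>A t. {X \<in> A \<rightarrow>\<^sub>E {0..}. (\<Sum>e\<in>A. \<alpha> e * X e) \<le> t}"
  interpret product_sigma_finite "\<lambda>_. lborel" by standard
  note [measurable] = simplex_slice_measurable[OF insert.hyps(1)]
  \<comment> \<open>The condition \<open>y \<le> t / a\<close> follows from nonnegativity of the
    remaining sum. It is kept explicit so that the slice has a nonnegative bound where the induction
    hypothesis is applied.\<close>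
  have step: "X(b := y) \<in> ?S (insert b A) t \<longleftrightarrow> y \<in> {0..t / a} \<and> X \<in> ?S A (t - a * y)"
    if "X \<in> space (?M A)" for X y
  proof -
    have eq: "(\<Sum>e\<in>A. \<alpha> e * (X(b := y)) e) = (\<Sum>e\<in>A. \<alpha> e * X e)"
      using insert.hyps by (intro sum.cong) auto
    have "0 \<le> (\<Sum>e\<in>A. \<alpha> e * X e)" if "\<forall>e\<in>A. X e \<ge> 0"
      using that insert.prems(2) by (intro sum_nonneg mult_nonneg_nonneg) (auto intro: less_imp_le)
    moreover have "X(b := y) \<in> insert b A \<rightarrow>\<^sub>E {0..} \<longleftrightarrow> y \<ge> 0 \<and> (\<forall>e\<in>A. X e \<ge> 0)"
      using insert.hyps that by (auto simp: space_PiM PiE_def Pi_def extensional_def)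
    moreover have "X \<in> A \<rightarrow>\<^sub>E {0..} \<longleftrightarrow> (\<forall>e\<in>A. X e \<ge> 0)"
      using that by (auto simp: space_PiM PiE_def Pi_def extensional_def)
    ultimately show ?thesis
      using insert.hyps eq a by (auto simp: a_def field_simps)
  qed
  have "emeasure (?M (insert b A)) (?S (insert b A) t) =
        (\<integral>\<^sup>+ X. indicator (?S (insert b A) t) X \<partial>?M (insert b A))"
    using insert.hyps by (subst nn_integral_indicator) (auto intro!: simplex_slice_measurable)
  also have "\<dots> = (\<integral>\<^sup>+ y. \<integral>\<^sup>+ X. indicator (?S (insert b A) t) (X(b := y)) \<partial>?M A \<partial>lborel)"
    using insert.hyps
    by (intro product_nn_integral_insert_rev) (auto intro!: borel_measurable_indicator simplex_slice_measurable)
  also have "\<dots> = (\<integral>\<^sup>+ y. \<integral>\<^sup>+ X. indicator {0..t / a} y * indicator (?S A (t - a * y)) X \<partial>?M A \<partial>lborel)"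
    using step by (intro nn_integral_cong) (auto simp: indicator_def)
  also have "\<dots> = (\<integral>\<^sup>+ y. indicator {0..t / a} y * emeasure (?M A) (?S A (t - a * y)) \<partial>lborel)"
    by (subst nn_integral_cmult) (auto intro!: nn_integral_cong)
  also have "\<dots> = (\<integral>\<^sup>+ y\<in>{0..t / a}. ennreal ((t - a * y) ^ m / c) \<partial>lborel)"
  proof (intro nn_integral_cong)
    fix y
    show "indicator {0..t / a} y * emeasure (?M A) (?S A (t - a * y)) =
        ennreal ((t - a * y) ^ m / c) * indicator {0..t / a} y"
    proof (cases "y \<in> {0..t / a}")
      case True
      then have "t - a * y \<ge> 0" using a by (auto simp: field_simps)
      then show ?thesis using True insert.IH[of "t - a * y"] insert.prems(2)
        by (simp add: m_def c_def)
    qed simp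
  qed
  also have "((\<lambda>y. - ((t - a * y) ^ Suc m / (a * Suc m * c))) has_real_derivative (t - a * y) ^ m / c) (at y)" for y
  proof -
    define K where "K = a * Suc m * c"
    have "K \<noteq> 0" using a c by (simp add: K_def)
    then have "((\<lambda>y. - ((t - a * y) ^ Suc m / K)) has_real_derivative
        a * Suc m * (t - a * y) ^ m / K) (at y)"
      by (auto intro!: derivative_eq_intros simp del: power_Suc simp: mult_ac)
    moreover have "a * Suc m * (t - a * y) ^ m / K = (t - a * y) ^ m / c"
      using a c by (simp add: K_def)
    ultimately show ?thesis by (simp only: K_def)
  qed
  then have "(\<integral>\<^sup>+ y\<in>{0..t / a}. ennreal ((t - a * y) ^ m / c) \<partial>lborel) =
      ennreal (- ((t - a * (t / a)) ^ Suc m / (a * Suc m * c)) - (- ((t - a * 0) ^ Suc m / (a * Suc m * c))))"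
    using a c insert.prems(1)
    by (intro nn_integral_FTC_Icc) (auto intro!: divide_nonneg_nonneg zero_le_power simp: field_simps)
  also have "- ((t - a * (t / a)) ^ Suc m / (a * Suc m * c)) - (- ((t - a * 0) ^ Suc m / (a * Suc m * c))) =
      t ^ Suc m / (fact (Suc m) * (a * prod \<alpha> A))"
    using a by (simp add: c_def mult_ac)
  finally show ?case using insert.hyps by (simp add: m_def a_def)
qed

section \<open>Comparison with independent exponential coordinates\<close>

lemma nn_integral_exp_Icc:
  fixes a p :: real
  assumes "a > 0" "p \<ge> 0"
  shows "(\<integral>\<^sup>+x\<in>{0..p}. ennreal (exp (- a * x)) \<partial>lborel) = ennreal ((1 - exp (- a * p)) / a)"
proof -
  have "(\<integral>\<^sup>+x\<in>{0..p}. ennreal (exp (- a * x)) \<partial>lborel) = ennreal (- exp (- a * p) / a - (- exp (- a * 0) / a))"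
    using assms by (intro nn_integral_FTC_Icc) (auto intro!: derivative_eq_intros)
  then show ?thesis using assms by (simp add: diff_divide_distrib)
qed

lemma nn_integral_exp_Ioi:
  fixes a p :: real
  assumes "a > 0"
  shows "(\<integral>\<^sup>+x\<in>{p<..}. ennreal (exp (- a * x)) \<partial>lborel) = ennreal (exp (- a * p) / a)"
proof -
  \<comment> \<open>The fundamental theorem is applied on the closed half-line, which differs by a
    null set.\<close>
  have "AE x in lborel. x \<noteq> p" by (rule AE_lborel_singleton)
  then have "(\<integral>\<^sup>+x\<in>{p<..}. ennreal (exp (- a * x)) \<partial>lborel) = (\<integral>\<^sup>+x\<in>{p..}. ennreal (exp (- a * x)) \<partial>lborel)"
    by (intro nn_integral_cong_AE, elim AE_mp) (auto simp: indicator_def)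
  also have "\<dots> = ennreal (0 - (- exp (- a * p) / a))"
  proof (intro nn_integral_FTC_atLeast)
    have "((\<lambda>x. exp (- (a * x))) \<longlongrightarrow> 0) at_top"
      using assms by real_asymp
    then have "((\<lambda>x. - exp (- (a * x)) / a) \<longlongrightarrow> - 0 / a) at_top"
      using assms by (intro tendsto_intros) auto
    then show "((\<lambda>x. - exp (- a * x) / a) \<longlongrightarrow> 0) at_top" by simp
  qed (use assms in \<open>auto intro!: derivative_eq_intros\<close>)
  finally show ?thesis by simp
qed

text \<open>The event depends only on which coordinates are at most \<open>p\<close>, so it is a
  finite union of boxes. Hence \<open>Q\<close> may be arbitrary.\<close>

lemma threshold_pattern_measurable:
  fixes p :: real
  assumes "finite E"
  shows "{X \<in> space (Pi\<^sub>M E (\<lambda>_. lborel)). Q (\<lambda>e. e \<in> E \<and> X e \<le> p)} \<in> sets (Pi\<^sub>M E (\<lambda>_. lborel))"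
proof -
  have "{X \<in> space (Pi\<^sub>M E (\<lambda>_. lborel)). Q (\<lambda>e. e \<in> E \<and> X e \<le> p)} =
      (\<Union>F\<in>{F \<in> Pow E. Q (\<lambda>e. e \<in> F)}. Pi\<^sub>E E (\<lambda>e. if e \<in> F then {..p} else {p<..}))" (is "?L = ?R")
  proof
    show "?L \<subseteq> ?R"
    proof
      fix X assume X: "X \<in> ?L"
      define F where "F = {e \<in> E. X e \<le> p}"
      have "F \<in> {F \<in> Pow E. Q (\<lambda>e. e \<in> F)}" using X by (auto simp: F_def)
      moreover have "X \<in> Pi\<^sub>E E (\<lambda>e. if e \<in> F then {..p} else {p<..})"
        using X by (auto simp: F_def space_PiM)
      ultimately show "X \<in> ?R" by blast
    qed
    show "?R \<subseteq> ?L"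
    proof
      fix X assume "X \<in> ?R"
      then obtain F where F: "F \<subseteq> E" "Q (\<lambda>e. e \<in> F)" "X \<in> Pi\<^sub>E E (\<lambda>e. if e \<in> F then {..p} else {p<..})"
        by auto
      have "X e \<le> p \<longleftrightarrow> e \<in> F" if "e \<in> E" for e
        using PiE_mem[OF F(3) that] by (auto split: if_splits)
      then have "(\<lambda>e. e \<in> E \<and> X e \<le> p) = (\<lambda>e. e \<in> F)"
        using F(1) by (auto simp: fun_eq_iff)
      then show "X \<in> ?L" using F by (simp add: space_PiM PiE_iff)
    qed
  qed
  also have "\<dots> \<in> sets (Pi\<^sub>M E (\<lambda>_. lborel))"
    using assms by (intro sets.finite_UN sets_PiM_I_finite) auto
  finally show ?thesis .
qed

text \<open>On the simplex \<open>1 \<le> exp (t - (\<Sum>e\<in>E. \<alpha> e * X e))\<close>, so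
  the indicator is dominated by a product of functions of one coordinate. Each factor integrates to
  a Bernoulli probability divided by \<open>\<alpha> e\<close>.\<close>

lemma emeasure_simplex_threshold_pattern_le:
  fixes \<alpha> :: "'a \<Rightarrow> real" and p t :: real
  assumes "finite E" "\<And>e. e \<in> E \<Longrightarrow> \<alpha> e > 0" "p \<ge> 0" "F \<subseteq> E"
  shows "emeasure (Pi\<^sub>M E (\<lambda>_. lborel))
           ({X \<in> E \<rightarrow>\<^sub>E {0..}. (\<Sum>e\<in>E. \<alpha> e * X e) \<le> t} \<inter>
            {X \<in> space (Pi\<^sub>M E (\<lambda>_. lborel)). (\<lambda>e. e \<in> E \<and> X e \<le> p) = (\<lambda>e. e \<in> F)}) \<le>
         ennreal (exp t / prod \<alpha> E *
           pmf (Pi_pmf E False (\<lambda>e. bernoulli_pmf (1 - exp (- \<alpha> e * p)))) (\<lambda>e. e \<in> F))"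
    (is "emeasure ?M (?S \<inter> ?B) \<le> _")
proof -
  interpret product_sigma_finite "\<lambda>_. lborel" by standard
  \<comment> \<open>Coordinates on the simplex are nonnegative, so a present edge may be confined to
    \<open>{0..p}\<close>.\<close>
  define J where "J = (\<lambda>e. if e \<in> F then {0..p} else {p<..})"
  define w where "w = (\<lambda>e. if e \<in> F then 1 - exp (- \<alpha> e * p) else exp (- \<alpha> e * p))"
  have w: "w e \<ge> 0" if "e \<in> E" for e
    using assms(2)[OF that] assms(3) by (auto simp: w_def)
  have "emeasure ?M (?S \<inter> ?B) = (\<integral>\<^sup>+X. indicator (?S \<inter> ?B) X \<partial>?M)"
    using assms(1) simplex_slice_measurable[OF assms(1)]
      threshold_pattern_measurable[OF assms(1), of "\<lambda>g. g = (\<lambda>e. e \<in> F)"]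
    by (subst nn_integral_indicator) auto
  also have "\<dots> \<le> (\<integral>\<^sup>+X. ennreal (exp t) * (\<Prod>e\<in>E. ennreal (exp (- \<alpha> e * X e)) * indicator (J e) (X e)) \<partial>?M)"
  proof (intro nn_integral_mono)
    fix X
    show "indicator (?S \<inter> ?B) X \<le> ennreal (exp t) * (\<Prod>e\<in>E. ennreal (exp (- \<alpha> e * X e)) * indicator (J e) (X e))"
    proof (cases "X \<in> ?S \<inter> ?B")
      case True
      then have "X e \<in> J e" if "e \<in> E" for e
        using that by (auto simp: J_def fun_eq_iff PiE_iff)
      then have "(\<Prod>e\<in>E. ennreal (exp (- \<alpha> e * X e)) * indicator (J e) (X e)) =
          (\<Prod>e\<in>E. ennreal (exp (- \<alpha> e * X e)))"
        by (intro prod.cong) auto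
      also have "\<dots> = ennreal (exp (- (\<Sum>e\<in>E. \<alpha> e * X e)))"
        using assms(1) by (simp add: prod_ennreal exp_sum flip: sum_negf)
      finally have "ennreal (exp t) * (\<Prod>e\<in>E. ennreal (exp (- \<alpha> e * X e)) * indicator (J e) (X e)) =
          ennreal (exp (t - (\<Sum>e\<in>E. \<alpha> e * X e)))"
        by (simp add: exp_diff exp_minus divide_inverse flip: ennreal_mult)
      also have "1 \<le> \<dots>" using True by simp
      finally show ?thesis using True by simp
    qed simp
  qed
  also have "\<dots> = ennreal (exp t) * (\<Prod>e\<in>E. \<integral>\<^sup>+x\<in>J e. ennreal (exp (- \<alpha> e * x)) \<partial>lborel)"
  proof (subst nn_integral_cmult)
    show "(\<lambda>X. \<Prod>e\<in>E. ennreal (exp (- \<alpha> e * X e)) * indicator (J e) (X e)) \<in> borel_measurable ?M"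
      using assms(1) by (intro borel_measurable_prod_ennreal) (simp add: J_def)
    show "ennreal (exp t) * (\<integral>\<^sup>+X. (\<Prod>e\<in>E. ennreal (exp (- \<alpha> e * X e)) * indicator (J e) (X e)) \<partial>?M) =
        ennreal (exp t) * (\<Prod>e\<in>E. \<integral>\<^sup>+x\<in>J e. ennreal (exp (- \<alpha> e * x)) \<partial>lborel)"
      using assms(1)
      by (subst product_nn_integral_prod[where f = "\<lambda>e x. ennreal (exp (- \<alpha> e * x)) * indicator (J e) x"])
        (auto simp: J_def)
  qed
  also have "(\<Prod>e\<in>E. \<integral>\<^sup>+x\<in>J e. ennreal (exp (- \<alpha> e * x)) \<partial>lborel) = (\<Prod>e\<in>E. ennreal (w e / \<alpha> e))"
    using assms(2,3) by (intro prod.cong) (auto simp: J_def w_def nn_integral_exp_Icc[simplified] nn_integral_exp_Ioi[simplified])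
  also have "\<dots> = ennreal (prod w E / prod \<alpha> E)"
    using assms(2) w by (subst prod_ennreal) (auto simp: prod_dividef less_imp_le)
  also have "prod w E = pmf (Pi_pmf E False (\<lambda>e. bernoulli_pmf (1 - exp (- \<alpha> e * p)))) (\<lambda>e. e \<in> F)"
  proof -
    have "0 \<le> 1 - exp (- \<alpha> e * p) \<and> 1 - exp (- \<alpha> e * p) \<le> 1" if "e \<in> E" for e
      using assms(2)[OF that] assms(3) by simp
    then show ?thesis
      using assms(1,4) by (subst pmf_Pi') (auto simp: w_def intro!: prod.cong)
  qed
  finally show ?thesis by (simp add: mult_ac flip: ennreal_mult')
qed

text \<open>The bound for single patterns is summed over the patterns satisfying \<open>Q\<close>.
  Dividing by the volume cancels \<open>prod \<alpha> E\<close>, so the comparison constant does not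
  depend on the weights.\<close>

lemma measure_uniform_simplex_threshold_le:
  fixes \<alpha> :: "'a \<Rightarrow> real" and p t :: real
  assumes "finite E" "\<And>e. e \<in> E \<Longrightarrow> \<alpha> e > 0" "p \<ge> 0" "t > 0"
  shows "measure (uniform_measure (Pi\<^sub>M E (\<lambda>_. lborel)) {X \<in> E \<rightarrow>\<^sub>E {0..}. (\<Sum>e\<in>E. \<alpha> e * X e) \<le> t})
           {X \<in> space (Pi\<^sub>M E (\<lambda>_. lborel)). Q (\<lambda>e. e \<in> E \<and> X e \<le> p)} \<le>
         fact (card E) * exp t / t ^ card E *
           measure_pmf.prob (Pi_pmf E False (\<lambda>e. bernoulli_pmf (1 - exp (- \<alpha> e * p)))) {g. Q g}"
    (is "measure (uniform_measure ?M ?S) ?A \<le> ?c * measure_pmf.prob ?P _")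
proof -
  define \<F> where "\<F> = {F \<in> Pow E. Q (\<lambda>e. e \<in> F)}"
  define B where "B = (\<lambda>F. {X \<in> space ?M. (\<lambda>e. e \<in> E \<and> X e \<le> p) = (\<lambda>e. e \<in> F)})"
  have fin: "finite \<F>" using assms(1) by (simp add: \<F>_def)
  have B: "B F \<in> sets ?M" for F
    unfolding B_def by (rule threshold_pattern_measurable[OF assms(1)])
  have S: "?S \<in> sets ?M" by (rule simplex_slice_measurable[OF assms(1)])
  have A: "?A \<in> sets ?M" by (rule threshold_pattern_measurable[OF assms(1)])
  have \<alpha>: "prod \<alpha> E > 0" using assms(2) by (intro prod_pos) auto
  have "?S \<inter> ?A \<subseteq> (\<Union>F\<in>\<F>. ?S \<inter> B F)"
  proof
    fix X assume X: "X \<in> ?S \<inter> ?A"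
    then have "{e \<in> E. X e \<le> p} \<in> \<F>" "X \<in> B {e \<in> E. X e \<le> p}"
      by (auto simp: \<F>_def B_def)
    then show "X \<in> (\<Union>F\<in>\<F>. ?S \<inter> B F)" using X by blast
  qed
  then have "emeasure ?M (?S \<inter> ?A) \<le> emeasure ?M (\<Union>F\<in>\<F>. ?S \<inter> B F)"
    using S B fin by (intro emeasure_mono sets.finite_UN) auto
  also have "\<dots> \<le> (\<Sum>F\<in>\<F>. emeasure ?M (?S \<inter> B F))"
    using S B fin by (intro emeasure_subadditive_finite) auto
  also have "\<dots> \<le> (\<Sum>F\<in>\<F>. ennreal (exp t / prod \<alpha> E * pmf ?P (\<lambda>e. e \<in> F)))"
    unfolding B_def using assms
    by (intro sum_mono emeasure_simplex_threshold_pattern_le) (auto simp: \<F>_def)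
  also have "\<dots> = ennreal (exp t / prod \<alpha> E * (\<Sum>F\<in>\<F>. pmf ?P (\<lambda>e. e \<in> F)))"
    using \<alpha> by (subst sum_ennreal) (auto simp: sum_distrib_left)
  also have "(\<Sum>F\<in>\<F>. pmf ?P (\<lambda>e. e \<in> F)) = (\<Sum>g\<in>(\<lambda>F e. e \<in> F) ` \<F>. pmf ?P g)"
    by (subst sum.reindex) (auto simp: inj_on_def fun_eq_iff)
  also have "\<dots> = measure_pmf.prob ?P ((\<lambda>F e. e \<in> F) ` \<F>)"
    using fin by (simp add: measure_measure_pmf_finite)
  \<comment> \<open>\<open>{g. Q g}\<close> may contain patterns not supported in \<open>E\<close>,
    so the passage to it is by monotonicity.\<close>
  also have "ennreal (exp t / prod \<alpha> E * measure_pmf.prob ?P ((\<lambda>F e. e \<in> F) ` \<F>)) \<le>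
      ennreal (exp t / prod \<alpha> E * measure_pmf.prob ?P {g. Q g})"
    using \<alpha> by (intro ennreal_leI mult_left_mono measure_pmf.finite_measure_mono) (auto simp: \<F>_def)
  finally have le: "emeasure ?M (?S \<inter> ?A) \<le> ennreal (exp t / prod \<alpha> E * measure_pmf.prob ?P {g. Q g})" .
  have vol: "emeasure ?M ?S = ennreal (t ^ card E / (fact (card E) * prod \<alpha> E))"
    using assms by (intro emeasure_weighted_simplex) auto
  have "emeasure (uniform_measure ?M ?S) ?A = emeasure ?M (?S \<inter> ?A) / emeasure ?M ?S"
    using S A by (intro emeasure_uniform_measure)
  also have "\<dots> \<le> ennreal (exp t / prod \<alpha> E * measure_pmf.prob ?P {g. Q g}) / emeasure ?M ?S"
    using le by (rule divide_right_mono_ennreal)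
  also have "\<dots> = ennreal (?c * measure_pmf.prob ?P {g. Q g})"
    unfolding vol using \<alpha> assms(4)
    by (subst divide_ennreal) (auto intro!: mult_nonneg_nonneg simp: field_simps)
  finally show ?thesis
    unfolding measure_def using assms(4) by (intro enn2real_leI) auto
qed

text \<open>Passing from \<open>N\<close> to \<open>N + 1\<close> multiplies the left side by
  \<open>exp 1 * (N / (N + 1)) ^ N\<close>, which is at most \<open>(N + 1) / N\<close> because
  \<open>exp 1 \<le> ((N + 1) / N) ^ (N + 1)\<close>. With \<open>t = N\<close> above, leaving the
  uniform measure thus costs a factor linear in the dimension.\<close>

lemma fact_mult_exp_le:
  assumes "N \<ge> 1"
  shows "fact N * exp (real N) / real N ^ N \<le> exp 1 * real N"
  using assms
proof (induction N rule: dec_induct)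
  case (step N)
  then have N: "real N > 0" by simp
  \<comment> \<open>This is the tangent bound
    \<open>ln N - ln (N + 1) \<le> - 1 / (N + 1)\<close>.\<close>
  have "1 \<le> real (Suc N) * ln (real (Suc N) / real N)"
    using ln_one_plus_pos_lower_bound[of 1] ln_diff_le[of "real N" "real (Suc N)"] N
    by (simp add: ln_div field_simps)
  then have "exp 1 \<le> exp (real (Suc N) * ln (real (Suc N) / real N))" by simp
  also have "\<dots> = (real (Suc N) / real N) ^ Suc N"
    using N by (subst exp_of_nat_mult) simp
  finally have "exp 1 * real N * real N ^ N \<le> real (Suc N) ^ Suc N"
    using N by (simp add: power_divide field_simps del: of_nat_Suc)
  moreover have "fact N * exp (real N) \<le> exp 1 * real N * real N ^ N"
    using step.IH N by (simp add: field_simps)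
  ultimately have "fact N * exp (real N) \<le> real (Suc N) ^ Suc N" by linarith
  then have "(real (Suc N) * exp 1) * (fact N * exp (real N)) \<le> (real (Suc N) * exp 1) * real (Suc N) ^ Suc N"
    by (intro mult_left_mono) auto
  moreover have "fact (Suc N) * exp (real (Suc N)) = (real (Suc N) * exp 1) * (fact N * exp (real N))"
    by (simp add: exp_add algebra_simps)
  ultimately show ?case
    by (simp add: divide_le_eq mult_ac del: of_nat_Suc power_Suc fact_Suc)
qed simp

section \<open>Independent edges\<close>

text \<open>\<open>A\<close> reads only coordinates in \<open>D\<close> and \<open>B\<close> only
  the others, so splitting the product law over \<open>D\<close> and \<open>E - D\<close> places
  them on different factors.\<close>

lemma prob_Pi_pmf_conj:
  assumes "finite E" "D \<subseteq> E"
    and A: "\<And>g h. (\<And>e. e \<in> D \<Longrightarrow> g e = h e) \<Longrightarrow> A g = A h"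
    and B: "\<And>g h. (\<And>e. e \<notin> D \<Longrightarrow> g e = h e) \<Longrightarrow> B g = B h"
  shows "measure_pmf.prob (Pi_pmf E d q) {g. A g \<and> B g} =
         measure_pmf.prob (Pi_pmf E d q) {g. A g} * measure_pmf.prob (Pi_pmf E d q) {g. B g}"
proof -
  have fin: "finite D" "finite (E - D)" and E: "E = D \<union> (E - D)"
    using assms by (auto intro: finite_subset)
  define P where "P = pair_pmf (Pi_pmf D d q) (Pi_pmf (E - D) d q)"
  have prob: "measure_pmf.prob (Pi_pmf E d q) {g. R g} =
      measure_pmf.prob P {(f, g). R (\<lambda>x. if x \<in> D then f x else g x)}" for R
    unfolding P_def by (subst E, subst Pi_pmf_union[OF fin]) (auto simp: case_prod_unfold vimage_def)
  have A': "A (\<lambda>x. if x \<in> D then f x else g x) = A f" for f g by (rule A) auto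
  have B': "B (\<lambda>x. if x \<in> D then f x else g x) = B g" for f g by (rule B) auto
  have "measure_pmf.prob P {(f, g). A f \<and> B g} =
      measure_pmf.prob (Pi_pmf D d q) {f. A f} * measure_pmf.prob (Pi_pmf (E - D) d q) {g. B g}"
  proof -
    \<comment> \<open>Intersecting with the supports yields the countable sets that the product rule
      asks for.\<close>
    have "measure_pmf.prob P {(f, g). A f \<and> B g} =
        measure_pmf.prob P (({f. A f} \<inter> set_pmf (Pi_pmf D d q)) \<times> ({g. B g} \<inter> set_pmf (Pi_pmf (E - D) d q)))"
      by (intro measure_prob_cong_0) (auto simp: P_def set_pmf_eq pmf_pair)
    also have "\<dots> = measure_pmf.prob (Pi_pmf D d q) ({f. A f} \<inter> set_pmf (Pi_pmf D d q)) *
        measure_pmf.prob (Pi_pmf (E - D) d q) ({g. B g} \<inter> set_pmf (Pi_pmf (E - D) d q))"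
      unfolding P_def by (intro measure_pmf_prob_product) auto
    finally show ?thesis by (simp add: measure_Int_set_pmf)
  qed
  moreover have "measure_pmf.prob P {(f, g). A f} = measure_pmf.prob (Pi_pmf D d q) {f. A f}"
    using measure_map_pmf[of fst P "{f. A f}"]
    by (simp add: P_def map_fst_pair_pmf vimage_def case_prod_unfold)
  moreover have "measure_pmf.prob P {(f, g). B g} = measure_pmf.prob (Pi_pmf (E - D) d q) {g. B g}"
    using measure_map_pmf[of snd P "{g. B g}"]
    by (simp add: P_def map_snd_pair_pmf vimage_def case_prod_unfold)
  ultimately show ?thesis
    by (simp add: prob A' B')
qed

lemma prob_Pi_pmf_Ball:
  assumes "finite E" "D \<subseteq> E"
  shows "measure_pmf.prob (Pi_pmf E d q) {g. \<forall>e\<in>D. R (g e)} = (\<Prod>e\<in>D. measure_pmf.prob (q e) {b. R b})"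
proof -
  have "{g. \<forall>e\<in>D. R (g e)} = Pi E (\<lambda>e. if e \<in> D then {b. R b} else UNIV)"
    using assms(2) by (auto simp: Pi_def)
  then have "measure_pmf.prob (Pi_pmf E d q) {g. \<forall>e\<in>D. R (g e)} =
      (\<Prod>e\<in>E. if e \<in> D then measure_pmf.prob (q e) {b. R b} else 1)"
    using assms(1) by (simp add: measure_Pi_pmf_Pi if_distrib[of "measure_pmf.prob _"] cong: if_cong)
  also have "\<dots> = (\<Prod>e\<in>D. measure_pmf.prob (q e) {b. R b})"
    using assms by (subst prod.inter_restrict[symmetric]) (auto simp: Int_absorb1)
  finally show ?thesis .
qed

text \<open>The bound \<open>s\<close> on presence drives the degree estimate, the bound
  \<open>r\<close> on absence drives the exploration. As an upper bound, \<open>s\<close> may exceed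
  1.\<close>

locale random_edges =
  fixes n :: nat and q :: "nat set \<Rightarrow> real" and s r :: real
  assumes q_nonneg: "\<And>e. e \<in> edges_K n \<Longrightarrow> 0 \<le> q e"
    and q_le: "\<And>e. e \<in> edges_K n \<Longrightarrow> q e \<le> s"
    and q_le_1: "\<And>e. e \<in> edges_K n \<Longrightarrow> q e \<le> 1"
    and q_ge: "\<And>e. e \<in> edges_K n \<Longrightarrow> 1 - q e \<le> r"
    and s_nonneg: "s \<ge> 0" and r_nonneg: "r \<ge> 0" and r_le_1: "r \<le> 1"
begin

definition edge_pmf :: "(nat set \<Rightarrow> bool) pmf" where
  "edge_pmf = Pi_pmf (edges_K n) False (\<lambda>e. bernoulli_pmf (q e))"

lemma finite_edges: "finite (edges_K n)"
  by (simp add: finite_imp_finite_nsets)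

lemma AE_subset_edges: "AE g in edge_pmf. {e. g e} \<subseteq> edges_K n"
  using set_Pi_pmf_subset[OF finite_edges, of False "\<lambda>e. bernoulli_pmf (q e)"]
  by (auto simp: AE_measure_pmf_iff edge_pmf_def)

section \<open>Union bounds for present and absent edges\<close>

lemma prob_all_present:
  assumes "D \<subseteq> edges_K n"
  shows "measure_pmf.prob edge_pmf {g. \<forall>e\<in>D. g e} \<le> s ^ card D"
proof -
  have "measure_pmf.prob edge_pmf {g. \<forall>e\<in>D. g e} = (\<Prod>e\<in>D. measure_pmf.prob (bernoulli_pmf (q e)) {b. b})"
    unfolding edge_pmf_def using prob_Pi_pmf_Ball[OF finite_edges assms, of False _ "\<lambda>b. b"] by simp
  also have "\<dots> \<le> (\<Prod>e\<in>D. s)"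
  proof (intro prod_mono conjI)
    fix e assume "e \<in> D"
    then have "e \<in> edges_K n" using assms by auto
    moreover have "{b. b} = {True}" by auto
    ultimately show "measure_pmf.prob (bernoulli_pmf (q e)) {b. b} \<le> s"
      using q_nonneg q_le q_le_1 by (simp add: measure_pmf_single)
  qed simp
  finally show ?thesis by simp
qed

lemma prob_all_absent:
  assumes "D \<subseteq> edges_K n"
  shows "measure_pmf.prob edge_pmf {g. \<forall>e\<in>D. \<not> g e} \<le> r ^ card D"
proof -
  have "measure_pmf.prob edge_pmf {g. \<forall>e\<in>D. \<not> g e} = (\<Prod>e\<in>D. measure_pmf.prob (bernoulli_pmf (q e)) {b. \<not> b})"
    unfolding edge_pmf_def using prob_Pi_pmf_Ball[OF finite_edges assms, of False _ "\<lambda>b. \<not> b"] by simp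
  also have "\<dots> \<le> (\<Prod>e\<in>D. r)"
  proof (intro prod_mono conjI)
    fix e assume "e \<in> D"
    then have "e \<in> edges_K n" using assms by auto
    moreover have "{b. \<not> b} = {False}" by auto
    ultimately show "measure_pmf.prob (bernoulli_pmf (q e)) {b. \<not> b} \<le> r"
      using q_nonneg q_ge q_le_1 by (simp add: measure_pmf_single)
  qed simp
  finally show ?thesis by simp
qed

lemma prob_Bex_le:
  assumes "finite I" "\<And>i. i \<in> I \<Longrightarrow> measure_pmf.prob edge_pmf {g. R i g} \<le> c"
  shows "measure_pmf.prob edge_pmf {g. \<exists>i\<in>I. R i g} \<le> real (card I) * c"
proof -
  have "measure_pmf.prob edge_pmf {g. \<exists>i\<in>I. R i g} = measure_pmf.prob edge_pmf (\<Union>i\<in>I. {g. R i g})"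
    by (rule arg_cong[of _ _ "measure_pmf.prob edge_pmf"]) auto
  also have "\<dots> \<le> (\<Sum>i\<in>I. measure_pmf.prob edge_pmf {g. R i g})"
    using assms(1) by (intro measure_pmf.finite_measure_subadditive_finite) auto
  also have "\<dots> \<le> (\<Sum>i\<in>I. c)" by (intro sum_mono assms(2))
  finally show ?thesis by simp
qed

text \<open>Union bound over the sets of \<open>m\<close> potential neighbours, of which there are
  at most \<open>n ^ m / fact m\<close>.\<close>

lemma prob_degree_ge:
  assumes "u \<in> {1..n}"
  shows "measure_pmf.prob edge_pmf {g. m \<le> card {x \<in> {1..n} - {u}. g {u, x}}} \<le> (real n * s) ^ m / fact m"
proof -
  define \<T> where "\<T> = {T. T \<subseteq> {1..n} - {u} \<and> card T = m}"
  have "measure_pmf.prob edge_pmf {g. m \<le> card {x \<in> {1..n} - {u}. g {u, x}}} \<le>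
      measure_pmf.prob edge_pmf {g. \<exists>T\<in>\<T>. \<forall>x\<in>T. g {u, x}}"
  proof (intro measure_pmf.finite_measure_mono subsetI)
    fix g assume "g \<in> {g. m \<le> card {x \<in> {1..n} - {u}. g {u, x}}}"
    then obtain T where "T \<subseteq> {x \<in> {1..n} - {u}. g {u, x}}" "card T = m"
      using obtain_subset_with_card_n by (metis (lifting) mem_Collect_eq)
    then have "T \<in> \<T>" "\<forall>x\<in>T. g {u, x}" by (auto simp: \<T>_def)
    then show "g \<in> {g. \<exists>T\<in>\<T>. \<forall>x\<in>T. g {u, x}}" by blast
  qed simp
  also have "\<dots> \<le> real (card \<T>) * s ^ m"
  proof (rule prob_Bex_le)
    fix T assume T: "T \<in> \<T>"
    have "inj_on (\<lambda>x. {u, x}) T" by (auto simp: inj_on_def doubleton_eq_iff)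
    then have "card ((\<lambda>x. {u, x}) ` T) = m" using T by (simp add: card_image \<T>_def)
    moreover have "(\<lambda>x. {u, x}) ` T \<subseteq> edges_K n"
      using T assms by (auto simp: \<T>_def)
    ultimately show "measure_pmf.prob edge_pmf {g. \<forall>x\<in>T. g {u, x}} \<le> s ^ m"
      using prob_all_present[of "(\<lambda>x. {u, x}) ` T"] by simp
  qed (simp add: \<T>_def)
  also have "card \<T> = (n - 1) choose m"
    using assms by (simp add: \<T>_def n_subsets)
  also have "real ((n - 1) choose m) * s ^ m \<le> (real n ^ m / fact m) * s ^ m"
  proof (intro mult_right_mono)
    have "real ((n - 1) choose m) * fact m \<le> real (n - 1) ^ m"
      using binomial_fact_pow[of "n - 1" m] by (metis of_nat_fact of_nat_le_iff of_nat_mult of_nat_power)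
    also have "\<dots> \<le> real n ^ m" by (intro power_mono) auto
    finally show "real ((n - 1) choose m) \<le> real n ^ m / fact m" by (simp add: field_simps)
  qed (simp add: s_nonneg)
  finally show ?thesis by (simp add: power_mult_distrib)
qed

text \<open>If fewer than \<open>t\<close> vertices of \<open>W\<close> are reached, some
  \<open>card W - t\<close> of them have no edge to \<open>S\<close>. Disjointness of
  \<open>S\<close> and \<open>W\<close> makes the absent pairs distinct, and a union bound over the
  unreached sets finishes.\<close>

lemma prob_few_neighbours:
  assumes "S \<subseteq> {1..n}" "W \<subseteq> {1..n}" "S \<inter> W = {}" "t \<le> card W"
  shows "measure_pmf.prob edge_pmf {g. card {y \<in> W. \<exists>x\<in>S. g {x, y}} < t} \<le>
         real (card W) ^ t * r ^ (card S * (card W - t))"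
proof -
  have fin: "finite S" "finite W" using assms by (auto intro: finite_subset)
  define \<U> where "\<U> = {U. U \<subseteq> W \<and> card U = card W - t}"
  have "measure_pmf.prob edge_pmf {g. card {y \<in> W. \<exists>x\<in>S. g {x, y}} < t} \<le>
      measure_pmf.prob edge_pmf {g. \<exists>U\<in>\<U>. \<forall>x\<in>S. \<forall>y\<in>U. \<not> g {x, y}}"
  proof (intro measure_pmf.finite_measure_mono subsetI)
    fix g assume g: "g \<in> {g. card {y \<in> W. \<exists>x\<in>S. g {x, y}} < t}"
    define Y where "Y = {y \<in> W. \<exists>x\<in>S. g {x, y}}"
    have "Y \<subseteq> W" unfolding Y_def by blast
    then have "finite Y" using fin(2) by (rule finite_subset)
    moreover have "card Y < t" using g unfolding Y_def mem_Collect_eq .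
    ultimately have le: "card W - t \<le> card (W - Y)"
      using diff_card_le_card_Diff[of Y W] by linarith
    obtain U where "U \<subseteq> W - Y" "card U = card W - t"
      using obtain_subset_with_card_n[OF le] by blast
    then have "U \<in> \<U>" "\<forall>x\<in>S. \<forall>y\<in>U. \<not> g {x, y}" by (auto simp: \<U>_def Y_def)
    then show "g \<in> {g. \<exists>U\<in>\<U>. \<forall>x\<in>S. \<forall>y\<in>U. \<not> g {x, y}}" by blast
  qed simp
  also have "\<dots> \<le> real (card \<U>) * r ^ (card S * (card W - t))"
  proof (rule prob_Bex_le)
    fix U assume U: "U \<in> \<U>"
    have "inj_on (\<lambda>(x, y). {x, y}) (S \<times> U)"
      using U assms(3) by (auto simp: inj_on_def doubleton_eq_iff \<U>_def)
    then have "card ((\<lambda>(x, y). {x, y}) ` (S \<times> U)) = card S * (card W - t)"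
      using U by (simp add: card_image card_cartesian_product \<U>_def)
    moreover have "(\<lambda>(x, y). {x, y}) ` (S \<times> U) \<subseteq> edges_K n"
    proof safe
      fix x y assume "x \<in> S" "y \<in> U"
      then show "{x, y} \<in> edges_K n"
        unfolding mem_edges_K_iff using U assms(1-3) by (auto simp: \<U>_def)
    qed
    moreover have "{g. \<forall>x\<in>S. \<forall>y\<in>U. \<not> g {x, y}} = {g. \<forall>e\<in>(\<lambda>(x, y). {x, y}) ` (S \<times> U). \<not> g e}"
      by auto
    ultimately show "measure_pmf.prob edge_pmf {g. \<forall>x\<in>S. \<forall>y\<in>U. \<not> g {x, y}} \<le> r ^ (card S * (card W - t))"
      using prob_all_absent[of "(\<lambda>(x, y). {x, y}) ` (S \<times> U)"] by simp
  qed (simp add: \<U>_def fin)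
  \<comment> \<open>Counting complements instead gives the exponent \<open>t\<close>, which is small
    compared with \<open>card W\<close> in the application.\<close>
  also have "card \<U> = card W choose t"
    using fin assms(4) by (simp add: \<U>_def n_subsets binomial_symmetric[symmetric])
  also have "real (card W choose t) * r ^ (card S * (card W - t)) \<le>
      real (card W) ^ t * r ^ (card S * (card W - t))"
    using binomial_le_pow[OF assms(4)] r_nonneg
    by (intro mult_right_mono) (metis of_nat_le_iff of_nat_power, simp)
  finally show ?thesis .
qed

text \<open>
  Explore from the frontier \<open>S\<close> one step at a time: each step spends \<open>L\<close> fresh vertices
  of \<open>V\<close>, in which the frontier grows by the factor \<open>b\<close>. The edges used by a step are
  disjoint from those used later, whence independence.
\<close>

lemma prob_not_hits:
  assumes \<eta>: "real L ^ b * r ^ (L - b ^ K) \<le> \<eta>" "r ^ (b ^ K) \<le> \<eta>" "\<eta> \<le> 1"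
    and L: "b \<ge> 1" "b ^ K \<le> L" and v: "v \<in> {1..n}"
    and "i + j = K" "S \<subseteq> {1..n}" "V \<subseteq> {1..n}" "S \<inter> V = {}" "v \<notin> S" "v \<notin> V"
    and "b ^ i \<le> card S" "j * L \<le> card V"
  shows "measure_pmf.prob edge_pmf {g. \<forall>x\<in>S. \<not> hits g V v j x} \<le> real (Suc j) * \<eta>"
  using assms(7-)
proof (induction j arbitrary: i S V)
  case 0
  \<comment> \<open>No growth step is left: the frontier has at least \<open>b ^ K\<close> vertices,
    and all its edges to \<open>v\<close> must be absent.\<close>
  have "inj_on (\<lambda>x. {x, v}) S" by (auto simp: inj_on_def doubleton_eq_iff)
  then have "card ((\<lambda>x. {x, v}) ` S) = card S" by (simp add: card_image)
  moreover have "(\<lambda>x. {x, v}) ` S \<subseteq> edges_K n"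
    unfolding image_subset_iff mem_edges_K_iff using 0 v by auto
  ultimately have "measure_pmf.prob edge_pmf {g. \<forall>x\<in>S. \<not> hits g V v 0 x} \<le> r ^ card S"
    using prob_all_absent[of "(\<lambda>x. {x, v}) ` S"] by simp
  also have "\<dots> \<le> r ^ (b ^ K)"
    using 0 r_nonneg r_le_1 by (intro power_decreasing) auto
  finally show ?case using \<eta>(2) by simp
next
  case (Suc j)
  have fin: "finite V" "finite S" using Suc.prems by (auto intro: finite_subset)
  obtain W where W: "W \<subseteq> V" "card W = L"
    using obtain_subset_with_card_n[of L V] Suc.prems by auto
  define V' where "V' = V - W"
  define t where "t = b ^ Suc i"
  have "finite W" using W fin by (auto intro: finite_subset)
  then have V': "card V' \<ge> j * L"
    using W Suc.prems by (simp add: V'_def card_Diff_subset)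
  have t: "t \<le> b ^ K" unfolding t_def using L(1) Suc.prems(1) by (intro power_increasing) auto
  define N where "N = (\<lambda>g. {y \<in> W. \<exists>x\<in>S. g {x, y}})"
  define \<T> where "\<T> = {T \<in> Pow W. t \<le> card T}"
  define R where "R = (\<lambda>T g. \<forall>y\<in>T. \<not> hits g V' v j y)"
  have fin\<T>: "finite \<T>" using \<open>finite W\<close> by (simp add: \<T>_def)
  have r01: "0 \<le> r" "r \<le> 1" using r_nonneg r_le_1 by auto

  have "measure_pmf.prob edge_pmf {g. card (N g) < t} \<le> real L ^ t * r ^ (card S * (L - t))"
    using prob_few_neighbours[of S W t] Suc.prems W L(2) t by (auto simp: N_def)
  also have "\<dots> \<le> real L ^ t * r ^ (b ^ i * (L - b ^ K))"
    using Suc.prems t r01 by (intro mult_left_mono power_decreasing mult_le_mono) auto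
  \<comment> \<open>Since \<open>t = b * b ^ i\<close>, both exponents contain the factor
    \<open>b ^ i\<close>. So the single hypothesis on \<open>\<eta>\<close> serves every
    step.\<close>
  also have "\<dots> = (real L ^ b * r ^ (L - b ^ K)) ^ (b ^ i)"
    by (simp add: t_def power_mult_distrib power_mult[symmetric] mult.commute)
  also have "\<dots> \<le> \<eta> ^ (b ^ i)"
    using \<eta>(1) r01 by (intro power_mono) auto
  also have "\<dots> \<le> \<eta> ^ 1"
    using \<eta> r01 L(1) by (intro power_decreasing) (auto intro: order_trans[OF zero_le_power])
  finally have few: "measure_pmf.prob edge_pmf {g. card (N g) < t} \<le> \<eta>" by simp

  have step: "measure_pmf.prob edge_pmf {g. N g = T \<and> R T g} \<le>
      measure_pmf.prob edge_pmf {g. N g = T} * (real (Suc j) * \<eta>)" if "T \<in> \<T>" for T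
  proof -
    \<comment> \<open>The edges in \<open>D\<close> determine the new frontier \<open>N g\<close>.
      The continuation from \<open>T\<close> reads only edges meeting \<open>v\<close> or
      \<open>V'\<close>, and these are not in \<open>D\<close>.\<close>
    define D where "D = (\<lambda>(x, y). {x, y}) ` (S \<times> W)"
    have D: "D \<subseteq> edges_K n"
      unfolding D_def
    proof safe
      fix x y assume "x \<in> S" "y \<in> W"
      then show "{x, y} \<in> edges_K n"
        unfolding mem_edges_K_iff using Suc.prems W by auto
    qed
    have D': "e \<inter> insert v V' = {}" if "e \<in> D" for e
      using that W Suc.prems by (auto simp: D_def V'_def)
    have "measure_pmf.prob edge_pmf {g. N g = T \<and> R T g} =
        measure_pmf.prob edge_pmf {g. N g = T} * measure_pmf.prob edge_pmf {g. R T g}"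
      unfolding edge_pmf_def
    proof (rule prob_Pi_pmf_conj[OF finite_edges D])
      fix g h :: "nat set \<Rightarrow> bool"
      assume "\<And>e. e \<in> D \<Longrightarrow> g e = h e"
      then have "N g = N h" unfolding N_def D_def by fast
      then show "(N g = T) = (N h = T)" by simp
    next
      fix g h :: "nat set \<Rightarrow> bool"
      assume "\<And>e. e \<notin> D \<Longrightarrow> g e = h e"
      then have "hits g V' v j y = hits h V' v j y" for y
        using D' by (intro hits_cong) auto
      then show "R T g = R T h" by (simp add: R_def)
    qed
    also have "measure_pmf.prob edge_pmf {g. R T g} \<le> real (Suc j) * \<eta>"
      unfolding R_def using that Suc.prems W V'
      by (intro Suc.IH[of "Suc i"]) (auto simp: \<T>_def V'_def t_def)
    finally show ?thesis by (simp add: mult_left_mono)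
  qed
  have "measure_pmf.prob edge_pmf {g. \<forall>x\<in>S. \<not> hits g V v (Suc j) x} \<le>
      measure_pmf.prob edge_pmf ({g. card (N g) < t} \<union> (\<Union>T\<in>\<T>. {g. N g = T \<and> R T g}))"
  proof (intro measure_pmf.finite_measure_mono subsetI)
    fix g assume g: "g \<in> {g. \<forall>x\<in>S. \<not> hits g V v (Suc j) x}"
    have "\<not> hits g V' v j y" if "y \<in> N g" for y
      using that g W hits_mono[of g V' v j y V] by (auto simp: N_def V'_def)
    then have "R (N g) g" by (simp add: R_def)
    moreover have "N g \<subseteq> W" by (auto simp: N_def)
    ultimately show "g \<in> {g. card (N g) < t} \<union> (\<Union>T\<in>\<T>. {g. N g = T \<and> R T g})"
      by (auto simp: \<T>_def not_less)
  qed simp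
  also have "\<dots> \<le> measure_pmf.prob edge_pmf {g. card (N g) < t} +
      measure_pmf.prob edge_pmf (\<Union>T\<in>\<T>. {g. N g = T \<and> R T g})"
    by (intro measure_subadditive) auto
  also have "measure_pmf.prob edge_pmf (\<Union>T\<in>\<T>. {g. N g = T \<and> R T g}) \<le>
      (\<Sum>T\<in>\<T>. measure_pmf.prob edge_pmf {g. N g = T \<and> R T g})"
    using fin\<T> by (intro measure_pmf.finite_measure_subadditive_finite) auto
  also have "\<dots> \<le> (\<Sum>T\<in>\<T>. measure_pmf.prob edge_pmf {g. N g = T} * (real (Suc j) * \<eta>))"
    by (intro sum_mono step)
  \<comment> \<open>The events \<open>N g = T\<close> are disjoint, so the bound on the continuation
    is paid once and not once for each \<open>T\<close>.\<close>
  also have "\<dots> = measure_pmf.prob edge_pmf (\<Union>T\<in>\<T>. {g. N g = T}) * (real (Suc j) * \<eta>)"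
    using fin\<T> by (subst measure_pmf.finite_measure_finite_Union)
      (auto simp: disjoint_family_on_def sum_distrib_right)
  also have "\<dots> \<le> 1 * (real (Suc j) * \<eta>)"
    using \<eta>(2) r01 by (intro mult_right_mono mult_nonneg_nonneg) (auto intro: order_trans[OF zero_le_power])
  finally show ?case using few by (simp add: algebra_simps)
qed

text \<open>Outside the bad events all degrees are at most \<open>m - 1\<close>, so balls of radius
  \<open>K\<close> have at most \<open>m ^ K < n\<close> vertices, and any two distinct vertices are
  joined by a walk of \<open>Suc K\<close> edges. The two terms are union bounds over vertices and
  over ordered pairs.\<close>

lemma prob_graph_diameter_neq:
  assumes \<eta>: "real L ^ b * r ^ (L - b ^ K) \<le> \<eta>" "r ^ (b ^ K) \<le> \<eta>" "\<eta> \<le> 1"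
    and L: "b \<ge> 1" "b ^ K \<le> L" "K * L \<le> n - 2"
    and m: "m \<ge> 1" "m ^ K < n"
  shows "measure_pmf.prob edge_pmf {g. graph_diameter (edge_graph n g) \<noteq> ereal (Suc K)} \<le>
           real n * ((real n * s) ^ m / fact m) + real n ^ 2 * (real (Suc K) * \<eta>)"
proof -
  define I where "I = {(u, v). u \<in> {1..n} \<and> v \<in> {1..n} \<and> u \<noteq> v}"
  have I_sub: "I \<subseteq> {1..n} \<times> {1..n}" by (auto simp: I_def)
  then have finI: "finite I" by (rule finite_subset) simp
  have "card I \<le> n ^ 2"
    using card_mono[OF _ I_sub] by (simp add: card_cartesian_product power2_eq_square)
  then have cardI: "real (card I) \<le> real n ^ 2"
    by (metis of_nat_le_iff of_nat_power)
  have \<eta>0: "0 \<le> \<eta>" using \<eta>(2) r_nonneg zero_le_power order_trans by blast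
  define D1 where "D1 = (\<lambda>u g. m \<le> card {x \<in> {1..n} - {u}. g {u, x :: nat}})"
  \<comment> \<open>The quantifier over a singleton presents the start as a frontier of size
    \<open>b ^ 0\<close>.\<close>
  define D2 where "D2 = (\<lambda>uv g. \<forall>x\<in>{fst uv}. \<not> hits g ({1..n} - {fst uv, snd uv}) (snd uv) K x)"
  have incl: "(\<exists>u\<in>{1..n}. D1 u g) \<or> (\<exists>uv\<in>I. D2 uv g)"
    if g: "{e. g e} \<subseteq> edges_K n" and neq: "graph_diameter (edge_graph n g) \<noteq> ereal (Suc K)" for g
  proof (rule ccontr)
    assume *: "\<not> ?thesis"
    have "graph_diameter (edge_graph n g) \<le> ereal (Suc K)"
    proof (rule graph_diameter_le[OF g])
      fix u v assume "u \<in> {1..n}" "v \<in> {1..n}" "u \<noteq> v"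
      then have "(u, v) \<in> I" by (simp add: I_def)
      then have "\<not> D2 (u, v) g" using * by blast
      then show "hits g ({1..n} - {u, v}) v K u" by (simp add: D2_def)
    qed
    moreover have "graph_diameter (edge_graph n g) \<ge> ereal (Suc K)"
    proof (rule graph_diameter_ge)
      fix u
      have sub: "{x. g {u, x}} \<subseteq> {1..n} - {u}"
      proof
        fix x assume "x \<in> {x. g {u, x}}"
        then have "{u, x} \<in> edges_K n" using g by blast
        then show "x \<in> {1..n} - {u}" unfolding mem_edges_K_iff by auto
      qed
      then show "finite {x. g {u, x}}" by (rule finite_subset) simp
      show "card {x. g {u, x}} \<le> m - 1"
      proof (cases "u \<in> {1..n}")
        case True
        have "{x \<in> {1..n} - {u}. g {u, x}} = {x. g {u, x}}" using sub by blast
        moreover have "\<not> m \<le> card {x \<in> {1..n} - {u}. g {u, x}}"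
          using True * unfolding D1_def by blast
        ultimately show ?thesis by simp
      next
        case False
        have "{x. g {u, x}} = {}"
        proof (rule equals0I)
          fix x assume "x \<in> {x. g {u, x}}"
          then have "{u, x} \<in> edges_K n" using g by blast
          then show False using False unfolding mem_edges_K_iff by auto
        qed
        then show ?thesis by simp
      qed
    next
      show "Suc (m - 1) ^ K < n" using m by simp
    qed
    ultimately show False using neq by simp
  qed
  have "measure_pmf.prob edge_pmf {g. graph_diameter (edge_graph n g) \<noteq> ereal (Suc K)} \<le>
      measure_pmf.prob edge_pmf ({g. \<exists>u\<in>{1..n}. D1 u g} \<union> {g. \<exists>uv\<in>I. D2 uv g})"
  proof (rule measure_pmf.finite_measure_mono_AE)
    \<comment> \<open>Patterns with an edge outside \<open>edges_K n\<close> have probability zero,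
      so the inclusion is needed only almost surely.\<close>
    show "AE g in edge_pmf. g \<in> {g. graph_diameter (edge_graph n g) \<noteq> ereal (Suc K)} \<longrightarrow>
        g \<in> {g. \<exists>u\<in>{1..n}. D1 u g} \<union> {g. \<exists>uv\<in>I. D2 uv g}"
      using AE_subset_edges by eventually_elim (use incl in blast)
  qed simp
  also have "\<dots> \<le> measure_pmf.prob edge_pmf {g. \<exists>u\<in>{1..n}. D1 u g} + measure_pmf.prob edge_pmf {g. \<exists>uv\<in>I. D2 uv g}"
    by (intro measure_subadditive) auto
  also have "\<dots> \<le> real (card {1..n}) * ((real n * s) ^ m / fact m) + real (card I) * (real (Suc K) * \<eta>)"
  proof (intro add_mono prob_Bex_le)
    fix u assume "u \<in> {1..n}"
    then show "measure_pmf.prob edge_pmf {g. D1 u g} \<le> (real n * s) ^ m / fact m"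
      unfolding D1_def by (rule prob_degree_ge)
  next
    fix uv assume uv: "uv \<in> I"
    obtain u v where [simp]: "uv = (u, v)" by (cases uv)
    have "card ({1..n} - {u, v}) = n - 2"
      using uv by (subst card_Diff_subset) (auto simp: I_def)
    then show "measure_pmf.prob edge_pmf {g. D2 uv g} \<le> real (Suc K) * \<eta>"
      unfolding D2_def using uv L
      by (intro prob_not_hits[OF \<eta> L(1,2), where i = 0]) (auto simp: I_def)
  qed (use finI in auto)
  also have "\<dots> \<le> real n * ((real n * s) ^ m / fact m) + real n ^ 2 * (real (Suc K) * \<eta>)"
    using mult_right_mono[OF cardI, of "real (Suc K) * \<eta>"] \<eta>0 by simp
  finally show ?thesis .
qed

end

section \<open>The threshold graph of the simplex\<close>

text \<open>The complementary event is compared with independent edges, whose presence probability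
  is at most \<open>A * p\<close> by \<open>1 - exp (- x) \<le> x\<close>. The prefactor
  \<open>exp 1 * real n ^ 2\<close> is the price of the comparison in dimension
  \<open>n choose 2\<close>.\<close>

lemma simplex_measure_graph_diameter:
  fixes a A p \<eta> :: real
  assumes n: "n \<ge> 2" and \<alpha>: "\<And>e. e \<in> edges_K n \<Longrightarrow> a \<le> \<alpha> e \<and> \<alpha> e \<le> A" and a: "a > 0" and p: "p \<ge> 0"
    and \<eta>: "real L ^ b * exp (- a * p) ^ (L - b ^ K) \<le> \<eta>" "exp (- a * p) ^ (b ^ K) \<le> \<eta>" "\<eta> \<le> 1"
    and L: "b \<ge> 1" "b ^ K \<le> L" "K * L \<le> n - 2"
    and m: "m \<ge> 1" "m ^ K < n"
  shows "\<bar>measure (simplex_measure n \<alpha>) {X \<in> space (simplex_measure n \<alpha>).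
            graph_diameter (threshold_graph n p X) = ereal (Suc K)} - 1\<bar> \<le>
         exp 1 * real n ^ 2 * (real n * ((real n * (A * p)) ^ m / fact m) + real n ^ 2 * (real (Suc K) * \<eta>))"
    (is "\<bar>measure ?S ?G - 1\<bar> \<le> _ * _ * ?b")
proof -
  define E where "E = edges_K n"
  define N where "N = n choose 2"
  define Q where "Q = (\<lambda>g. graph_diameter (edge_graph n g) \<noteq> ereal (Suc K))"
  have E: "finite E" "card E = N"
    by (simp_all add: E_def N_def finite_imp_finite_nsets)
  have N: "N \<ge> 1" using n by (simp add: N_def Suc_le_eq)
  have \<alpha>pos: "\<alpha> e > 0" if "e \<in> E" for e using \<alpha>[of e] that a by (auto simp: E_def)
  have A: "A > 0"
  proof -
    obtain e where "e \<in> E" using E N by fastforce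
    then show ?thesis using \<alpha>pos[of e] \<alpha>[of e] by (auto simp: E_def)
  qed
  have S: "?S = uniform_measure (Pi\<^sub>M E (\<lambda>_. lborel)) {X \<in> E \<rightarrow>\<^sub>E {0..}. (\<Sum>e\<in>E. \<alpha> e * X e) \<le> real N}"
    by (simp add: simplex_measure_def simplex_set_def E_def N_def)
  have vol: "emeasure (Pi\<^sub>M E (\<lambda>_. lborel)) {X \<in> E \<rightarrow>\<^sub>E {0..}. (\<Sum>e\<in>E. \<alpha> e * X e) \<le> real N} =
      ennreal (real N ^ N / (fact N * prod \<alpha> E))"
    using emeasure_weighted_simplex[OF E(1), of "real N" \<alpha>] \<alpha>pos E(2) by simp
  have "prod \<alpha> E > 0" using \<alpha>pos by (intro prod_pos) auto
  then have "real N ^ N / (fact N * prod \<alpha> E) > 0" using N by simp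
  then interpret S: prob_space ?S
    unfolding S using vol by (intro prob_space_uniform_measure) auto
  have spc: "space ?S = space (Pi\<^sub>M E (\<lambda>_. lborel))" by (simp add: S)
  define Bad where "Bad = {X \<in> space (Pi\<^sub>M E (\<lambda>_. lborel)). Q (\<lambda>e. e \<in> E \<and> X e \<le> p)}"
  have "Bad \<in> sets ?S"
    unfolding Bad_def S sets_uniform_measure by (rule threshold_pattern_measurable[OF E(1)])
  moreover have G: "?G = space ?S - Bad"
    unfolding spc Bad_def Q_def E_def threshold_graph_eq_edge_graph by blast
  ultimately have "measure ?S ?G = 1 - measure ?S Bad"
    by (simp add: S.prob_compl)
  then have "\<bar>measure ?S ?G - 1\<bar> = measure ?S Bad" by simp
  moreover have "measure ?S Bad \<le> fact (card E) * exp (real N) / real N ^ card E *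
      measure_pmf.prob (Pi_pmf E False (\<lambda>e. bernoulli_pmf (1 - exp (- \<alpha> e * p)))) {g. Q g}"
    unfolding S Bad_def using E \<alpha>pos p N
    by (intro measure_uniform_simplex_threshold_le) auto
  moreover have le_b: "measure_pmf.prob (Pi_pmf E False (\<lambda>e. bernoulli_pmf (1 - exp (- \<alpha> e * p)))) {g. Q g} \<le> ?b"
  proof -
    interpret random_edges n "\<lambda>e. 1 - exp (- \<alpha> e * p)" "A * p" "exp (- a * p)"
    proof
      fix e assume e: "e \<in> edges_K n"
      then have pos: "\<alpha> e > 0" using \<alpha>pos by (simp add: E_def)
      show "0 \<le> 1 - exp (- \<alpha> e * p)" using pos p by simp
      have "1 - exp (- \<alpha> e * p) \<le> \<alpha> e * p" using exp_ge_add_one_self[of "- \<alpha> e * p"] by simp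
      also have "\<dots> \<le> A * p" using \<alpha>[OF e] p by (intro mult_right_mono) auto
      finally show "1 - exp (- \<alpha> e * p) \<le> A * p" .
      show "1 - exp (- \<alpha> e * p) \<le> 1" by simp
      show "1 - (1 - exp (- \<alpha> e * p)) \<le> exp (- a * p)"
        using \<alpha>[OF e] p by (simp add: mult_right_mono)
    qed (use A a p in auto)
    show ?thesis
      using prob_graph_diameter_neq[OF \<eta> L m] by (simp only: edge_pmf_def E_def Q_def)
  qed
  moreover have "fact (card E) * exp (real N) / real N ^ card E \<le> exp 1 * real n ^ 2"
  proof -
    have "real N \<le> real n ^ 2"
      unfolding N_def using binomial_le_pow[of 2 n] n by (metis of_nat_le_iff of_nat_power)
    then show ?thesis
      using fact_mult_exp_le[OF N] by (simp add: E(2) order_trans[OF _ mult_left_mono])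
  qed
  ultimately show ?thesis
    using mult_mono[of "fact (card E) * exp (real N) / real N ^ card E" "exp 1 * real n ^ 2"
        "measure_pmf.prob (Pi_pmf E False (\<lambda>e. bernoulli_pmf (1 - exp (- \<alpha> e * p)))) {g. Q g}" ?b]
    by simp
qed

section \<open>Asymptotic choice of the parameters\<close>

lemma eventually_le_powr:
  fixes c w :: real
  assumes "w > 0"
  shows "eventually (\<lambda>n. c \<le> real n powr w) sequentially"
  using assms by real_asymp

text \<open>One term of the exponential series gives \<open>m ^ m / fact m \<le> exp m\<close>, and
  \<open>y \<le> exp (- 2) * m\<close> contributes \<open>exp (- 2 * m)\<close>.\<close>

lemma power_div_fact_le:
  fixes y :: real
  assumes "y \<ge> 0" "m \<ge> 1" "exp 2 * y \<le> real m"
  shows "y ^ m / fact m \<le> exp (- real m)"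
proof -
  have "(\<Sum>i\<in>{m}. real m ^ i / fact i) \<le> (\<Sum>i. real m ^ i / fact i)"
    using summable_exp[of "real m"] by (intro sum_le_suminf) (auto simp: divide_inverse mult_ac)
  then have fact: "real m ^ m / fact m \<le> exp (real m)"
    by (simp add: exp_def divide_inverse mult_ac)
  have "y ^ m \<le> (exp (- 2) * real m) ^ m"
    using assms by (intro power_mono) (auto simp: exp_minus field_simps)
  then have "y ^ m / fact m \<le> exp (- 2) ^ m * (real m ^ m / fact m)"
    by (simp add: power_mult_distrib divide_right_mono)
  also have "\<dots> \<le> exp (- 2) ^ m * exp (real m)"
    using fact by (intro mult_left_mono) auto
  also have "\<dots> = exp (- real m)"
    by (simp add: exp_of_nat_mult[symmetric] exp_add[symmetric])
  finally show ?thesis .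
qed

lemma nat_ceiling_bounds:
  fixes y :: real
  assumes "y \<ge> 1"
  shows "y \<le> real (nat \<lceil>y\<rceil>)" "real (nat \<lceil>y\<rceil>) \<le> 2 * y" "nat \<lceil>y\<rceil> \<ge> 1"
  using assms by linarith+

text \<open>All asymptotic requirements enter as inequalities at a single \<open>n\<close>.
  Hypothesis \<open>m\<close> keeps balls of radius \<open>K\<close> below \<open>n\<close>
  vertices, \<open>b\<close> keeps the last frontier well below the reservoir size,
  \<open>e2\<close> absorbs the constant in the degree bound, and \<open>ln\<close> and
  \<open>c\<close> control one exploration step.\<close>

lemma diameter_error_le:
  fixes \<theta> \<epsilon> x :: real
  assumes k: "k = Suc K" "K \<ge> 1" and \<epsilon>: "\<epsilon> > 0" "\<epsilon> \<le> \<theta> / 2" "(real k + 1) * \<epsilon> \<le> real k * \<theta> - 1"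
    and x: "x = real n" "n \<ge> 2"
    and \<alpha>: "\<And>e. e \<in> edges_K n \<Longrightarrow> x powr - (\<epsilon> / 2) \<le> \<alpha> e \<and> \<alpha> e \<le> x powr (\<epsilon> / 2)"
    and L: "x / (2 * real k) \<le> (x - 2) / real K - 1"
    and ln: "16 * real k * ln x \<le> x powr (\<epsilon> / 2)"
    and m: "2 ^ K + 1 \<le> x powr (1 - real K * (\<theta> + \<epsilon>))"
    and e2: "exp 2 \<le> x powr (\<epsilon> / 2)"
    and b: "2 ^ K * (4 * real k) \<le> x powr (1 - real K * (\<theta> - \<epsilon>))"
    and c: "8 * real k \<le> x powr (\<theta> - \<epsilon> / 2 - \<epsilon>)"
  shows "\<bar>measure (simplex_measure n \<alpha>) {X \<in> space (simplex_measure n \<alpha>).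
            graph_diameter (threshold_graph n (x powr (\<theta> - 1)) X) = ereal (real k)} - 1\<bar> \<le>
         exp 1 * x ^ 2 * (x * exp (- (x powr \<epsilon>)) + x ^ 2 * (real k * exp (- (x powr \<epsilon>))))"
proof -
  define a where "a = x powr - (\<epsilon> / 2)"
  define A where "A = x powr (\<epsilon> / 2)"
  define p where "p = x powr (\<theta> - 1)"
  \<comment> \<open>Up to constants, expected degrees lie between
    \<open>x powr (\<theta> - \<epsilon> / 2)\<close> and
    \<open>x powr (\<theta> + \<epsilon> / 2)\<close>. The degree cap \<open>m'\<close> is taken
    above this range and the growth factor \<open>b'\<close> below it.\<close>
  define m' where "m' = nat \<lceil>x powr (\<theta> + \<epsilon>)\<rceil>"
  define b' where "b' = nat \<lceil>x powr (\<theta> - \<epsilon>)\<rceil>"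
  \<comment> \<open>\<open>K\<close> disjoint reservoirs of this size fit into the
    \<open>n - 2\<close> vertices other than the two endpoints.\<close>
  define L' where "L' = (n - 2) div K"
  define \<eta> where "\<eta> = exp (- (x powr \<epsilon>))"
  have x2: "x \<ge> 2" using x by simp
  have kpos: "real k > 0" using k by simp
  have m': "x powr (\<theta> + \<epsilon>) \<le> real m'" "real m' \<le> 2 * x powr (\<theta> + \<epsilon>)" "m' \<ge> 1"
    unfolding m'_def using x2 \<epsilon> by (intro nat_ceiling_bounds; auto intro!: ge_one_powr_ge_zero)+
  have b': "x powr (\<theta> - \<epsilon>) \<le> real b'" "real b' \<le> 2 * x powr (\<theta> - \<epsilon>)" "b' \<ge> 1"
    unfolding b'_def using x2 \<epsilon> by (intro nat_ceiling_bounds; auto intro!: ge_one_powr_ge_zero)+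
  have powr_K: "(x powr w) ^ K = x powr (real K * w)" for w
    using x2 by (simp add: powr_realpow[symmetric] powr_powr mult.commute)
  have ap: "a * p = x powr (\<theta> - 1 - \<epsilon> / 2)"
    by (simp add: a_def p_def powr_add[symmetric])
  have x_split: "x powr (1 - w) * x powr w = x" for w
    using x2 by (simp add: powr_add[symmetric])

  have "m' ^ K < n"
  proof -
    have "real m' ^ K \<le> (2 * x powr (\<theta> + \<epsilon>)) ^ K" using m' by (intro power_mono) auto
    also have "\<dots> = 2 ^ K * x powr (real K * (\<theta> + \<epsilon>))" by (simp add: power_mult_distrib powr_K)
    also have "\<dots> < x powr (1 - real K * (\<theta> + \<epsilon>)) * x powr (real K * (\<theta> + \<epsilon>))"
      using m x2 by (intro mult_strict_right_mono) auto
    finally have "real (m' ^ K) < x" by (simp only: x_split of_nat_power)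
    then show ?thesis using x(1) by simp
  qed

  \<comment> \<open>A reservoir has at least \<open>x / (2 * real k)\<close> vertices, so at least
    \<open>x / (4 * real k)\<close> remain once \<open>b' ^ K\<close> are removed.\<close>
  have bK: "real (b' ^ K) \<le> x / (4 * real k)"
  proof -
    have "real b' ^ K \<le> (2 * x powr (\<theta> - \<epsilon>)) ^ K" using b' by (intro power_mono) auto
    also have "\<dots> = 2 ^ K * x powr (real K * (\<theta> - \<epsilon>))" by (simp add: power_mult_distrib powr_K)
    finally have "real (b' ^ K) * (4 * real k) \<le> 2 ^ K * (4 * real k) * x powr (real K * (\<theta> - \<epsilon>))"
      using kpos by simp
    also have "\<dots> \<le> x powr (1 - real K * (\<theta> - \<epsilon>)) * x powr (real K * (\<theta> - \<epsilon>))"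
      using b by (intro mult_right_mono) auto
    finally have "real (b' ^ K) * (4 * real k) \<le> x" by (simp only: x_split)
    then show ?thesis using kpos by (simp add: field_simps)
  qed
  \<comment> \<open>The \<open>- 1\<close> in hypothesis \<open>L\<close> pays for the rounding in
    the integer division.\<close>
  have L': "x / (2 * real k) \<le> real L'"
    using L floor_divide_of_nat_eq[of "n - 2" K, where 'a = real]
      real_of_int_floor_ge_diff_one[of "real (n - 2) / real K"] x
    by (simp add: L'_def of_nat_diff)
  define h where "h = x / (4 * real k)"
  have "x / (2 * real k) = 2 * h" using kpos by (simp add: h_def)
  then have L2h: "2 * h \<le> real L'" using L' by simp
  have "h \<ge> 0" using x2 kpos by (simp add: h_def)
  then have "real (b' ^ K) \<le> real L'"
    using bK[folded h_def] L2h by linarith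
  then have bL: "b' ^ K \<le> L'" by (simp only: of_nat_le_iff)
  have diff: "x / (4 * real k) \<le> real (L' - b' ^ K)"
    using bL bK L2h unfolding h_def[symmetric] of_nat_diff[OF bL] by linarith
  have KL: "K * L' \<le> n - 2" by (simp add: L'_def)

  have exp_pow: "exp (- a * p) ^ j = exp (- (x powr (\<theta> - 1 - \<epsilon> / 2) * real j))" for j
    using ap by (simp add: exp_of_nat_mult[symmetric] mult.commute)
  \<comment> \<open>The absence factor has exponent at least
    \<open>x powr (\<theta> - \<epsilon> / 2) / (4 * real k)\<close>. Half of it outweighs
    \<open>L' ^ b'\<close>, the other half leaves \<open>x powr \<epsilon>\<close>.\<close>
  have \<eta>1: "real L' ^ b' * exp (- a * p) ^ (L' - b' ^ K) \<le> \<eta>"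
  proof -
    have "L' \<le> n" by (simp add: L'_def) (meson diff_le_self div_le_dividend order_trans)
    then have "real L' ^ b' \<le> x ^ b'" using x by (intro power_mono) auto
    also have "\<dots> = exp (real b' * ln x)" using x2 by (simp add: exp_of_nat_mult)
    also have "\<dots> \<le> exp (2 * x powr (\<theta> - \<epsilon>) * ln x)"
      using b' x2 by (simp add: mult_right_mono)
    finally have 1: "real L' ^ b' \<le> exp (2 * x powr (\<theta> - \<epsilon>) * ln x)" .
    have "x powr (\<theta> - 1 - \<epsilon> / 2) * (x / (4 * real k)) \<le> x powr (\<theta> - 1 - \<epsilon> / 2) * real (L' - b' ^ K)"
      using diff by (intro mult_left_mono) auto
    moreover have "x powr (\<theta> - 1 - \<epsilon> / 2) * x = x powr (\<theta> - \<epsilon> / 2)"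
      using x2 by (simp add: powr_mult_base mult.commute)
    ultimately have 2: "x powr (\<theta> - \<epsilon> / 2) / (4 * real k) \<le> x powr (\<theta> - 1 - \<epsilon> / 2) * real (L' - b' ^ K)"
      by simp
    have "x powr (\<theta> - \<epsilon>) * (16 * real k * ln x) \<le> x powr (\<theta> - \<epsilon>) * x powr (\<epsilon> / 2)"
      using ln by (intro mult_left_mono) auto
    then have 3: "2 * x powr (\<theta> - \<epsilon>) * ln x \<le> x powr (\<theta> - \<epsilon> / 2) / (8 * real k)"
      using kpos by (simp add: powr_add[symmetric] field_simps)
    have "x powr \<epsilon> * (8 * real k) \<le> x powr \<epsilon> * x powr (\<theta> - \<epsilon> / 2 - \<epsilon>)"
      using c by (intro mult_left_mono) auto
    then have 4: "x powr \<epsilon> \<le> x powr (\<theta> - \<epsilon> / 2) / (8 * real k)"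
      using kpos by (simp add: powr_add[symmetric] pos_le_divide_eq)
    have "real L' ^ b' * exp (- a * p) ^ (L' - b' ^ K) \<le>
        exp (2 * x powr (\<theta> - \<epsilon>) * ln x) * exp (- (x powr (\<theta> - \<epsilon> / 2) / (4 * real k)))"
      unfolding exp_pow using 1 2 by (intro mult_mono) auto
    also have "\<dots> = exp (2 * x powr (\<theta> - \<epsilon>) * ln x - x powr (\<theta> - \<epsilon> / 2) / (4 * real k))"
      by (simp add: exp_diff exp_minus field_simps)
    also have "\<dots> \<le> \<eta>"
    proof -
      have "x powr (\<theta> - \<epsilon> / 2) / (4 * real k) =
          x powr (\<theta> - \<epsilon> / 2) / (8 * real k) + x powr (\<theta> - \<epsilon> / 2) / (8 * real k)"
        using kpos by (simp add: field_simps)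
      then show ?thesis unfolding \<eta>_def exp_le_cancel_iff using 3 4 by linarith
    qed
    finally show ?thesis .
  qed
  have \<eta>2: "exp (- a * p) ^ (b' ^ K) \<le> \<eta>"
  proof -
    \<comment> \<open>The right side is
      \<open>real k * \<theta> - 1 - real K * \<epsilon> - \<epsilon> / 2\<close>, at least
      \<open>3 * \<epsilon> / 2\<close> by the third bound on \<open>\<epsilon>\<close>, which
      encodes \<open>real k * \<theta> > 1\<close>.\<close>
    have "\<epsilon> \<le> \<theta> - 1 - \<epsilon> / 2 + real K * (\<theta> - \<epsilon>)"
      using \<epsilon> k by (simp add: algebra_simps)
    then have "x powr \<epsilon> \<le> x powr (\<theta> - 1 - \<epsilon> / 2 + real K * (\<theta> - \<epsilon>))"
      using x2 by (intro powr_mono) auto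
    also have "\<dots> = x powr (\<theta> - 1 - \<epsilon> / 2) * (x powr (\<theta> - \<epsilon>)) ^ K"
      unfolding powr_K powr_add by simp
    also have "\<dots> \<le> x powr (\<theta> - 1 - \<epsilon> / 2) * real b' ^ K"
      using b' by (intro mult_left_mono power_mono) auto
    finally show ?thesis unfolding exp_pow \<eta>_def by simp
  qed
  have "\<eta> \<le> 1" by (simp add: \<eta>_def)

  \<comment> \<open>The bound \<open>x * (A * p)\<close> on the mean degree is smaller than
    \<open>m'\<close> by at least the factor \<open>x powr (\<epsilon> / 2)\<close>, itself at least
    \<open>exp 2\<close>.\<close>
  have deg: "(x * (A * p)) ^ m' / fact m' \<le> exp (- (x powr \<epsilon>))"
  proof -
    have "x * (A * p) = x powr (\<theta> + \<epsilon> / 2)"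
      using x2 by (simp add: A_def p_def powr_add[symmetric] powr_mult_base add.commute)
    moreover have "exp 2 * x powr (\<theta> + \<epsilon> / 2) \<le> x powr (\<epsilon> / 2) * x powr (\<theta> + \<epsilon> / 2)"
      using e2 by (intro mult_right_mono) auto
    moreover have "x powr (\<epsilon> / 2) * x powr (\<theta> + \<epsilon> / 2) = x powr (\<theta> + \<epsilon>)"
      by (simp add: powr_add[symmetric] add.commute)
    ultimately have "(x * (A * p)) ^ m' / fact m' \<le> exp (- real m')"
      using m' by (intro power_div_fact_le) auto
    also have "x powr \<epsilon> \<le> x powr (\<theta> + \<epsilon>)" using x2 \<epsilon> by (intro powr_mono) auto
    then have "exp (- real m') \<le> exp (- (x powr \<epsilon>))" using m' by simp
    finally show ?thesis .
  qed
  have "\<bar>measure (simplex_measure n \<alpha>) {X \<in> space (simplex_measure n \<alpha>).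
            graph_diameter (threshold_graph n p X) = ereal (Suc K)} - 1\<bar> \<le>
      exp 1 * real n ^ 2 * (real n * ((real n * (A * p)) ^ m' / fact m') + real n ^ 2 * (real (Suc K) * \<eta>))"
    using x(2) \<alpha> x2 \<eta>1 \<eta>2 \<open>\<eta> \<le> 1\<close> b'(3) bL KL m'(3) \<open>m' ^ K < n\<close>
    by (intro simplex_measure_graph_diameter) (auto simp: a_def A_def p_def)
  also have "\<dots> \<le> exp 1 * real n ^ 2 * (real n * exp (- (x powr \<epsilon>)) + real n ^ 2 * (real (Suc K) * \<eta>))"
    using deg x by (intro mult_left_mono add_right_mono) auto
  finally show ?thesis by (simp only: x k p_def \<eta>_def)
qed

theorem theorem2p9:
  fixes k :: nat and \<theta> :: real and M :: "nat \<Rightarrow> real" and \<delta> :: "nat \<Rightarrow> real"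
    and \<alpha> :: "nat \<Rightarrow> nat set \<Rightarrow> real" and p :: "nat \<Rightarrow> real"
  assumes "k \<ge> 2"
    and "\<delta> \<in> o(\<lambda>_. 1)"
    and "\<forall>\<^sub>F n in sequentially. M n = real n powr \<delta> n"
    and "\<And>n. bounded_by (M n) n (\<alpha> n)"
    and "1 / real k < \<theta>" and "\<theta> < 1 / (real k - 1)"
    and "\<And>n. p n = 1 / real n powr (1 - \<theta>)"
  shows "(\<lambda>n. measure (simplex_measure n (\<alpha> n))
           {X \<in> space (simplex_measure n (\<alpha> n)).
              graph_diameter (threshold_graph n (p n) X) = ereal (real k)}) \<longlonglongrightarrow> 1"
    (is "?f \<longlonglongrightarrow> 1")
proof -
  define K where "K = k - 1"
  define \<rho> where "\<rho> = real k * \<theta> - 1"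
  have k: "k = Suc K" "K \<ge> 1" "real k - 1 = real K" using assms(1) by (auto simp: K_def)
  have \<rho>: "\<rho> > 0" using assms(1,5) by (simp add: \<rho>_def field_simps)
  have \<theta>0: "\<theta> > 0" using assms(1,5) by (auto intro: less_trans[rotated])
  have K\<theta>: "real K * \<theta> < 1" using assms(6) k by (simp add: field_simps)
  define w where "w = 1 / real K - \<theta>"
  have w: "w > 0" using K\<theta> k by (simp add: w_def field_simps)
  \<comment> \<open>\<open>\<rho>\<close> and \<open>w\<close> measure the slack in the lower and
    upper bounds on \<open>\<theta>\<close>: the first makes the last exploration step succeed, the
    second keeps balls small, with \<open>w / 2\<close> giving a strict inequality. The term
    \<open>\<theta> / 2\<close> keeps the growth exponents positive.\<close>
  define \<epsilon> where "\<epsilon> = min (\<theta> / 2) (min (\<rho> / (real k + 1)) (w / 2))"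
  have \<epsilon>0: "\<epsilon> > 0" using \<rho> \<theta>0 w k by (simp add: \<epsilon>_def)
  have \<epsilon>1: "\<epsilon> \<le> \<theta> / 2" unfolding \<epsilon>_def by (rule min.cobounded1)
  have "\<epsilon> \<le> \<rho> / (real k + 1)" by (simp add: \<epsilon>_def)
  then have \<epsilon>2: "(real k + 1) * \<epsilon> \<le> \<rho>" by (simp add: field_simps)
  have "\<epsilon> \<le> w / 2" unfolding \<epsilon>_def by (intro min.coboundedI2 order_refl)
  then have "\<epsilon> < 1 / real K - \<theta>" using w unfolding w_def[symmetric] by linarith
  then have \<epsilon>3: "real K * (\<theta> + \<epsilon>) < 1" using k by (simp add: field_simps)
  have "real K * (\<theta> - \<epsilon>) \<le> real K * (\<theta> + \<epsilon>)" using \<epsilon>0 by (intro mult_left_mono) auto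
  then have \<epsilon>4: "real K * (\<theta> - \<epsilon>) < 1" using \<epsilon>3 by linarith

  \<comment> \<open>The union bounds and the comparison lose only powers of \<open>n\<close>,
    against the factor \<open>exp (- (real n powr \<epsilon>))\<close>.\<close>
  define bd where "bd = (\<lambda>n. exp 1 * real n ^ 2 *
      (real n * exp (- (real n powr \<epsilon>)) + real n ^ 2 * (real k * exp (- (real n powr \<epsilon>)))))"
  have "bd \<longlonglongrightarrow> 0"
    unfolding bd_def using \<epsilon>0 by real_asymp
  moreover have "\<forall>\<^sub>F n in sequentially. norm (?f n - 1) \<le> bd n"
  proof -
    \<comment> \<open>Here \<open>M n = n powr o(1)\<close> enters: eventually all weights lie
      within a factor \<open>real n powr (\<epsilon> / 2)\<close> of 1.\<close>
    have ev_\<delta>: "\<forall>\<^sub>F n in sequentially. \<bar>\<delta> n\<bar> \<le> \<epsilon> / 2"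
      using landau_o.smallD[OF assms(2), of "\<epsilon> / 2"] \<epsilon>0 by simp
    \<comment> \<open>Since \<open>1 / real K > 1 / (2 * real k)\<close>, a linear gain beats the
      constants lost to the two endpoints and to rounding.\<close>
    have evL: "\<forall>\<^sub>F n in sequentially. real n / (2 * real k) \<le> (real n - 2) / real K - 1"
    proof -
      have "real K < 2 * real k" "real K > 0" using k by simp_all
      then have "1 / real K - 1 / (2 * real k) > 0" by (simp add: field_simps)
      then have "\<forall>\<^sub>F n in sequentially. 2 / real K + 1 \<le> real n * (1 / real K - 1 / (2 * real k))"
        by real_asymp
      then show ?thesis by eventually_elim (simp add: diff_divide_distrib right_diff_distrib)
    qed
    have ev_ln: "\<forall>\<^sub>F n in sequentially. 16 * real k * ln (real n) \<le> real n powr (\<epsilon> / 2)"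
      using \<epsilon>0 by real_asymp
    have pos: "1 - real K * (\<theta> + \<epsilon>) > 0" "\<epsilon> / 2 > 0" "1 - real K * (\<theta> - \<epsilon>) > 0" "\<theta> - \<epsilon> / 2 - \<epsilon> > 0"
      using \<epsilon>0 \<epsilon>1 \<epsilon>3 \<epsilon>4 by auto
    show ?thesis
      using assms(3) ev_\<delta> evL ev_ln eventually_ge_at_top[of 2]
        eventually_le_powr[of "1 - real K * (\<theta> + \<epsilon>)" "2 ^ K + 1", OF pos(1)]
        eventually_le_powr[of "\<epsilon> / 2" "exp 2", OF pos(2)]
        eventually_le_powr[of "1 - real K * (\<theta> - \<epsilon>)" "2 ^ K * (4 * real k)", OF pos(3)]
        eventually_le_powr[of "\<theta> - \<epsilon> / 2 - \<epsilon>" "8 * real k", OF pos(4)]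
    proof eventually_elim
      case (elim n)
      have n: "real n \<ge> 2" using elim by simp
      have "p n = real n powr (\<theta> - 1)"
        using assms(7)[of n] powr_minus_divide[of "real n" "1 - \<theta>"] by simp
      moreover have "real n powr - (\<epsilon> / 2) \<le> \<alpha> n e \<and> \<alpha> n e \<le> real n powr (\<epsilon> / 2)" if "e \<in> edges_K n" for e
      proof -
        have "M n \<le> real n powr (\<epsilon> / 2)"
          using elim n by (auto intro!: powr_mono)
        moreover have "real n powr - (\<epsilon> / 2) \<le> 1 / M n"
          using elim n powr_minus_divide[of "real n" "\<delta> n"]
          by (auto intro!: powr_mono simp flip: powr_minus_divide)
        moreover have "1 / M n \<le> \<alpha> n e" "\<alpha> n e \<le> M n"
          using assms(4)[of n] that unfolding bounded_by_def by blast+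
        ultimately show ?thesis by linarith
      qed
      ultimately show ?case
        unfolding bd_def using elim diameter_error_le[OF k(1,2) \<epsilon>0 \<epsilon>1 \<epsilon>2[unfolded \<rho>_def] refl, of n "\<alpha> n"]
        by simp
    qed
  qed
  ultimately have "(\<lambda>n. ?f n - 1) \<longlonglongrightarrow> 0"
    by (rule Lim_null_comparison[rotated])
  then show ?thesis by (simp add: LIM_zero_iff)
qed

end
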